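(* The detection boundary $\rho_{\mathrm{BJ}}$ of the Berk–Jones statistic $\mathrm{BJ}_n^+$ satisfies $$\rho_{\mathrm{BJ}}(\beta)=\rho^*(\beta),\qquad \tfrac12<\beta<1,$$ where $$\rho^*(\beta)=\begin{cases}\beta-\tfrac12,& \tfrac12<\beta\le\tfrac34,\\ (1-\sqrt{1-\beta})^2,& \tfrac34<\beta<1.\end{cases}$$
   Context: Hypotheses: under $H_0$, $X_1,\dots,X_n$ are i.i.d. $N(0,1)$; under $H_1^{(n)}$, $X_1,\dots,X_n$ are i.i.d. from the mixture $(1-\varepsilon_n)N(0,1)+\varepsilon_nN(\mu_n,1)$, where $\varepsilon_n=n^{-\beta}$ with $\tfrac12<\beta<1$, and $\mu_n=\sqrt{2r\log(n)}$ with $0<r<1$. Let $p_i=P\{N(0,1)>X_i\}$ be the $p$-values and $p_{(1)}\le\dots\le p_{(n)}$ the sorted $p$-values. The Berk–Jones statistic is $$\mathrm{BJ}_n^+=n\cdot\max_{1\le i\le n/2}K^+(i/n,p_{(i)}),$$ where $$K^+(t,x)=\begin{cases} t\log\frac{t}{x}+(1-t)\log\frac{1-t}{1-x},& 0<x<t<1,\\ 0,& 0\le t\le x\le1,\\ +\infty,&\text{otherwise.}\end{cases}$$ The level-$\alpha$ Berk–Jones test rejects $H_0$ for large values of $\mathrm{BJ}_n^+$. The detection boundary $\rho_{\mathrm{BJ}}(\beta)$ is the function such that, if $\mu_n=\sqrt{2r\log(n)}$ and one uses a sequence of levels $\alpha=\alpha_n$ tending to $0$ slowly enough (no specific rate is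 prescribed), then for $r>\rho_{\mathrm{BJ}}(\beta)$ the procedure has power (probability of rejecting $H_0$ under $H_1^{(n)}$) tending to $1$ as $n\to\infty$, while for $r<\rho_{\mathrm{BJ}}(\beta)$ the procedure has power tending to $0$. *)

theory Defs
  imports "HOL-Probability.Probability"
begin

definition std_normal :: "real measure" where
  "std_normal = density lborel (\<lambda>x. ennreal (std_normal_density x))"

definition normal_mixture :: "real \<Rightarrow> real \<Rightarrow> real measure" where
  "normal_mixture \<epsilon> \<mu> = density lborel
     (\<lambda>x. ennreal ((1 - \<epsilon>) * normal_density 0 1 x + \<epsilon> * normal_density \<mu> 1 x))"

text \<open>
  Samples are the coordinate functions \<open>X 1, \<dots>, X n\<close> on the canonical product space, which are
  i.i.d. with the given marginal law.
\<close>

definition H0 :: "nat \<Rightarrow> (nat \<Rightarrow> real) measure" where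
  "H0 n = PiM {1..n} (\<lambda>_. std_normal)"

definition H1 :: "real \<Rightarrow> real \<Rightarrow> nat \<Rightarrow> (nat \<Rightarrow> real) measure" where
  "H1 \<beta> r n = PiM {1..n}
     (\<lambda>_. normal_mixture (real n powr (- \<beta>)) (sqrt (2 * r * ln (real n))))"

definition p_value :: "real \<Rightarrow> real" where
  "p_value x = measure std_normal {x<..}"

text \<open>The order statistics \<open>p\<^sub>(\<^sub>i\<^sub>)\<close>, indexed from 1.\<close>

definition sorted_p_value :: "nat \<Rightarrow> (nat \<Rightarrow> real) \<Rightarrow> nat \<Rightarrow> real" where
  "sorted_p_value n X i = sort (map (\<lambda>j. p_value (X j)) [1..<Suc n]) ! (i - 1)"

definition Kplus :: "real \<Rightarrow> real \<Rightarrow> ereal" where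
  "Kplus t x =
     (if 0 < x \<and> x < t \<and> t < 1 then ereal (t * ln (t / x) + (1 - t) * ln ((1 - t) / (1 - x)))
      else if 0 \<le> t \<and> t \<le> x \<and> x \<le> 1 then 0
      else \<infinity>)"

text \<open>For \<open>n < 2\<close> the maximum is over the empty set; only large \<open>n\<close> matters below.\<close>

definition BJ_plus :: "nat \<Rightarrow> (nat \<Rightarrow> real) \<Rightarrow> ereal" where
  "BJ_plus n X =
     ereal (real n) * (MAX i\<in>{1..n div 2}. Kplus (real i / real n) (sorted_p_value n X i))"

text \<open>
  The level-\<open>\<alpha>\<close> test based on a statistic \<open>T\<close> rejects when \<open>T > c\<close>, where \<open>c\<close> is the smallest
  critical value for which the probability of rejection under the null hypothesis is at most \<open>\<alpha>\<close>
  (the infimum is attained, by right-continuity of \<open>c \<mapsto> P(T > c)\<close>).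
\<close>

definition critical_value :: "(nat \<Rightarrow> (nat \<Rightarrow> real) \<Rightarrow> ereal) \<Rightarrow> nat \<Rightarrow> real \<Rightarrow> ereal" where
  "critical_value T n \<alpha> = Inf {c. measure (H0 n) {X \<in> space (H0 n). T n X > c} \<le> \<alpha>}"

definition power_of_test ::
  "(nat \<Rightarrow> (nat \<Rightarrow> real) \<Rightarrow> ereal) \<Rightarrow> real \<Rightarrow> real \<Rightarrow> nat \<Rightarrow> real \<Rightarrow> real" where
  "power_of_test T \<beta> r n \<alpha> =
     measure (H1 \<beta> r n) {X \<in> space (H1 \<beta> r n). T n X > critical_value T n \<alpha>}"

definition vanishing_levels :: "(nat \<Rightarrow> real) \<Rightarrow> bool" where
  "vanishing_levels \<alpha> \<longleftrightarrow> (\<forall>n. 0 < \<alpha> n \<and> \<alpha> n < 1) \<and> \<alpha> \<longlonglongrightarrow> 0"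

text \<open>
  ``Levels tending to 0 slowly enough'' means: there is a vanishing sequence \<open>\<alpha>\<^sub>0\<close> such that the
  assertion holds for all vanishing level sequences that eventually dominate \<open>\<alpha>\<^sub>0\<close>. The rate
  \<open>\<alpha>\<^sub>0\<close> does not depend on the parameters \<open>\<beta>\<close> and \<open>r\<close> of the alternative.
\<close>

definition is_detection_boundary ::
  "(nat \<Rightarrow> (nat \<Rightarrow> real) \<Rightarrow> ereal) \<Rightarrow> (real \<Rightarrow> real) \<Rightarrow> bool" where
  "is_detection_boundary T \<rho> \<longleftrightarrow>
     (\<exists>\<alpha>\<^sub>0. vanishing_levels \<alpha>\<^sub>0 \<and>
       (\<forall>\<alpha>. vanishing_levels \<alpha> \<and> (\<forall>\<^sub>F n in sequentially. \<alpha>\<^sub>0 n \<le> \<alpha> n) \<longrightarrow>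
         (\<forall>\<beta> r. 1/2 < \<beta> \<and> \<beta> < 1 \<and> 0 < r \<and> r < 1 \<longrightarrow>
           (\<rho> \<beta> < r \<longrightarrow> (\<lambda>n. power_of_test T \<beta> r n (\<alpha> n)) \<longlonglongrightarrow> 1) \<and>
           (r < \<rho> \<beta> \<longrightarrow> (\<lambda>n. power_of_test T \<beta> r n (\<alpha> n)) \<longlonglongrightarrow> 0))))"

definition rho_star :: "real \<Rightarrow> real" where
  "rho_star \<beta> = (if \<beta> \<le> 3/4 then \<beta> - 1/2 else (1 - sqrt (1 - \<beta>))\<^sup>2)"

end

theory Submission
  imports Defs "HOL-Real_Asymp.Real_Asymp"
begin

text \<open>
  Under the null hypothesis each order statistic obeys the Chernoff bound
  \<open>P(n K(i/n, p\<^sub>(\<^sub>i\<^sub>)) > c) \<le> exp (- c)\<close>, so by a union bound the critical value is at most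
  \<open>3 log n\<close> already for levels \<open>1/(n + 2)\<close>. This crude bound suffices, because above the boundary the
  statistic grows like a power of \<open>n\<close>: for a suitable \<open>w < 1\<close> the number of observations exceeding
  \<open>w sqrt (2 log n)\<close> is larger than expected under the null hypothesis by a polynomial factor times
  its standard deviation, and \<open>K(t, x) \<ge> (t - x)\<^sup>2 / (2 t)\<close> turns this excess into a lower bound
  for the statistic.

  Below the boundary no test has power. One truncates the likelihood ratio at \<open>sqrt (2 log n)\<close>; the
  part removed has total mass tending to 0, the second moment of the rest stays bounded, and by
  Cauchy--Schwarz the power is at most a constant times the square root of the level, up to \<open>o(1)\<close>.
\<close>

subsection \<open>Counting and order statistics of an i.i.d. sample\<close>

text \<open>The two branches of \<open>rho_star\<close> are two different obstructions. Without
  truncation, the second moment of the likelihood ratio over the sample is at most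
  \<open>exp (n * \<epsilon>^2 * exp (\<mu>^2))\<close>, which is
  \<open>exp (n powr (1 - 2 * \<beta> + 2 * r))\<close>; it is bounded for
  \<open>r \<le> \<beta> - 1/2\<close>. The expected number of signals above
  \<open>sqrt (2 * ln n)\<close>, roughly the largest null observation, has polynomial order
  \<open>1 - \<beta> - (1 - sqrt r)^2\<close>, which is negative exactly below the curve
  \<open>r = (1 - sqrt (1 - \<beta>))^2\<close>. Line and curve touch at
  \<open>\<beta> = 3/4\<close>, \<open>r = 1/4\<close>. Beyond that point the squared likelihood
  ratio has its mass around \<open>2 * \<mu>\<close>, to the right of the truncation point, and
  truncation pays. Every margin is a positive power of \<open>n\<close>. Gaussian tails are
  therefore needed only up to subpolynomial factors, and neither sharp tail asymptotics nor the
  limit law of the statistic enters.\<close>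

text \<open>Generating function of the binomial law: \<open>y\<close> to the count is a product with
  one factor per coordinate, so the integral over the product space factorises.\<close>

lemma nn_integral_PiM_power_card:
  assumes "prob_space M" "A \<in> sets M" "0 \<le> y" "finite I"
  shows "(\<integral>\<^sup>+X. ennreal (y ^ card {j\<in>I. X j \<in> A}) \<partial>PiM I (\<lambda>_. M))
    = ennreal ((1 + measure M A * (y - 1)) ^ card I)"
proof -
  interpret M: prob_space M by fact
  interpret P: product_sigma_finite "\<lambda>_. M" ..
  have [measurable]: "A \<in> sets M" by fact
  have le1: "measure M A \<le> 1" by simp
  \<comment> \<open>The sign matters because \<open>ennreal\<close> sends negative reals to 0. The
    expression is a convex combination of 1 and \<open>y\<close>.\<close>
  have nonneg: "0 \<le> 1 + measure M A * (y - 1)"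
  proof -
    have "1 + measure M A * (y - 1) = (1 - measure M A) + measure M A * y"
      by (simp add: algebra_simps)
    moreover have "0 \<le> measure M A * y" using assms(3) by simp
    ultimately show ?thesis using le1 by linarith
  qed
  have one: "(\<integral>\<^sup>+x. ennreal (if x \<in> A then y else 1) \<partial>M) = ennreal (1 + measure M A * (y - 1))"
  proof -
    have "(\<integral>\<^sup>+x. ennreal (if x \<in> A then y else 1) \<partial>M) =
        (\<integral>\<^sup>+x. ennreal y * indicator A x + indicator (space M - A) x \<partial>M)"
      by (intro nn_integral_cong) (auto simp: indicator_def)
    also have "\<dots> = ennreal y * emeasure M A + emeasure M (space M - A)"
      by (subst nn_integral_add) (auto simp: nn_integral_cmult)
    also have "\<dots> = ennreal (y * measure M A + (1 - measure M A))"
      using assms(3) le1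
      by (simp add: M.emeasure_eq_measure M.prob_compl ennreal_mult ennreal_plus)
    finally show ?thesis by (simp add: algebra_simps)
  qed
  have "(\<integral>\<^sup>+X. ennreal (y ^ card {j\<in>I. X j \<in> A}) \<partial>PiM I (\<lambda>_. M)) =
      (\<integral>\<^sup>+X. (\<Prod>j\<in>I. ennreal (if X j \<in> A then y else 1)) \<partial>PiM I (\<lambda>_. M))"
    using assms(3,4) by (intro nn_integral_cong) (simp add: prod_ennreal prod.inter_filter[symmetric])
  also have "\<dots> = (\<Prod>j\<in>I. (\<integral>\<^sup>+x. ennreal (if x \<in> A then y else 1) \<partial>M))"
    by (rule P.product_nn_integral_prod) (auto simp: assms)
  also have "\<dots> = ennreal (1 + measure M A * (y - 1)) ^ card I"
    by (simp add: one)
  finally show ?thesis using nonneg by (simp add: ennreal_power)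
qed

lemma measurable_card_PiM:
  assumes "finite I" "A \<in> sets M"
  shows "(\<lambda>X. real (card {j\<in>I. X j \<in> A})) \<in> borel_measurable (PiM I (\<lambda>_. M))"
proof -
  have [measurable]: "A \<in> sets M" by fact
  have "(\<lambda>X. \<Sum>j\<in>I. indicat_real A (X j)) \<in> borel_measurable (PiM I (\<lambda>_. M))"
    by measurable
  also have "(\<lambda>X. \<Sum>j\<in>I. indicat_real A (X j)) = (\<lambda>X. real (card {j\<in>I. X j \<in> A}))"
    using assms(1) by (auto simp: fun_eq_iff indicator_def sum.inter_filter[symmetric] Int_def)
  finally show ?thesis .
qed

lemma sets_card_PiM:
  assumes "finite I" "A \<in> sets M"
  shows "{X \<in> space (PiM I (\<lambda>_. M)). k \<le> card {j\<in>I. X j \<in> A}} \<in> sets (PiM I (\<lambda>_. M))"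
proof -
  note [measurable] = measurable_card_PiM[OF assms]
  have "{X \<in> space (PiM I (\<lambda>_. M)). real k \<le> real (card {j\<in>I. X j \<in> A})} \<in> sets (PiM I (\<lambda>_. M))"
    by measurable
  then show ?thesis by simp
qed

text \<open>The choice \<open>y > 1\<close> gives upper tail bounds for the count, \<open>y < 1\<close> lower tail bounds.\<close>

lemma prob_card_le_chernoff:
  assumes "prob_space M" "A \<in> sets M" "0 < y" "finite I"
    and S: "S \<in> sets (PiM I (\<lambda>_. M))"
    and le: "\<And>X. X \<in> S \<Longrightarrow> y powr s \<le> y ^ card {j\<in>I. X j \<in> A}"
  shows "measure (PiM I (\<lambda>_. M)) S \<le> (1 + measure M A * (y - 1)) ^ card I * y powr (- s)"
proof -
  interpret M: prob_space M by fact
  interpret P: product_prob_space "\<lambda>_. M" ..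
  let ?N = "\<lambda>X. card {j\<in>I. X j \<in> A}"
  have [measurable]: "S \<in> sets (PiM I (\<lambda>_. M))" by fact
  have [measurable]: "A \<in> sets M" by fact
  have nonneg: "0 \<le> 1 + measure M A * (y - 1)"
  proof -
    have "1 + measure M A * (y - 1) = (1 - measure M A) + measure M A * y"
      by (simp add: algebra_simps)
    moreover have "0 \<le> measure M A * y" using assms(3) by simp
    moreover have "measure M A \<le> 1" by simp
    ultimately show ?thesis by linarith
  qed
  have "ennreal (measure (PiM I (\<lambda>_. M)) S) = (\<integral>\<^sup>+X. indicator S X \<partial>PiM I (\<lambda>_. M))"
    by (simp add: P.emeasure_eq_measure)
  also have "\<dots> \<le> (\<integral>\<^sup>+X. ennreal (y powr (- s)) * ennreal (y ^ ?N X) \<partial>PiM I (\<lambda>_. M))"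
  proof (intro nn_integral_mono)
    fix X
    \<comment> \<open>Markov's inequality in pointwise form.\<close>
    have "1 \<le> y powr (- s) * y ^ ?N X" if "X \<in> S"
      using le[OF that] assms(3) by (simp add: powr_minus field_simps)
    then show "indicator S X \<le> ennreal (y powr (- s)) * ennreal (y ^ ?N X)"
      by (auto simp: indicator_def simp flip: ennreal_mult')
  qed
  also have "\<dots> = ennreal (y powr (- s)) * (\<integral>\<^sup>+X. ennreal (y ^ ?N X) \<partial>PiM I (\<lambda>_. M))"
  proof (intro nn_integral_cmult)
    have "(\<lambda>X. y powr real (?N X)) \<in> borel_measurable (PiM I (\<lambda>_. M))"
      using measurable_card_PiM[OF assms(4,2)] by measurable
    then show "(\<lambda>X. ennreal (y ^ ?N X)) \<in> borel_measurable (PiM I (\<lambda>_. M))"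
      using assms(3) by (simp add: powr_realpow)
  qed
  also have "\<dots> = ennreal (y powr (- s) * (1 + measure M A * (y - 1)) ^ card I)"
    using assms nonneg by (simp add: nn_integral_PiM_power_card ennreal_mult)
  finally show ?thesis
    using nonneg by (simp add: mult.commute)
qed

text \<open>In a sorted list the entries \<open>\<le> x\<close> form a prefix, so its length decides
  which indices belong to it.\<close>

lemma sorted_nth_le_iff:
  fixes ys :: "'a::linorder list"
  assumes "sorted ys" "i < length ys"
  shows "ys ! i \<le> x \<longleftrightarrow> i < length (filter (\<lambda>y. y \<le> x) ys)"
  using assms
proof (induction ys arbitrary: i)
  case (Cons y ys)
  show ?case
  proof (cases "y \<le> x")
    case True
    with Cons show ?thesis by (cases i) auto
  next
    case False
    have "filter (\<lambda>z. z \<le> x) (y # ys) = []"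
      using False Cons.prems by (auto simp: filter_empty_conv)
    moreover have "y \<le> (y # ys) ! i"
      using Cons.prems by (cases i) auto
    ultimately show ?thesis using False by (metis list.size(3) not_less0 order_trans)
  qed
qed simp

text \<open>The bridge from order statistics to binomial counts, where Chernoff bounds apply. Order
  statistics are indexed from 1 and lists from 0, which turns \<open>i - 1 <\<close> into
  \<open>i \<le>\<close>.\<close>

lemma sorted_p_value_le_iff:
  assumes "i \<in> {1..n}"
  shows "sorted_p_value n X i \<le> x \<longleftrightarrow> i \<le> card {j\<in>{1..n}. p_value (X j) \<le> x}"
proof -
  let ?xs = "map (\<lambda>j. p_value (X j)) [1..<Suc n]"
  have "sorted_p_value n X i \<le> x \<longleftrightarrow> i - 1 < length (filter (\<lambda>y. y \<le> x) (sort ?xs))"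
    unfolding sorted_p_value_def using assms by (intro sorted_nth_le_iff) auto
  also have "length (filter (\<lambda>y. y \<le> x) (sort ?xs)) = length (filter (\<lambda>y. y \<le> x) ?xs)"
    by (metis filter_sort length_sort)
  also have "\<dots> = length (filter (\<lambda>j. p_value (X j) \<le> x) [1..<Suc n])"
    by (simp only: filter_map length_map comp_def)
  also have "\<dots> = card (set (filter (\<lambda>j. p_value (X j) \<le> x) [1..<Suc n]))"
    by (intro distinct_card[symmetric]) simp
  also have "set (filter (\<lambda>j. p_value (X j) \<le> x) [1..<Suc n]) = {j\<in>{1..n}. p_value (X j) \<le> x}"
    by auto
  finally show ?thesis using assms by auto
qed

lemma sorted_p_value_mem:
  assumes "i \<in> {1..n}"
  shows "\<exists>j\<in>{1..n}. sorted_p_value n X i = p_value (X j)"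
proof -
  have "sorted_p_value n X i \<in> set (sort (map (\<lambda>j. p_value (X j)) [1..<Suc n]))"
    unfolding sorted_p_value_def using assms by (intro nth_mem) auto
  then show ?thesis by auto
qed

subsection \<open>Normal distributions and p-values\<close>

lemma normal_density_tilt:
  "normal_density \<mu> 1 x = normal_density 0 1 x * exp (\<mu> * x - \<mu>\<^sup>2 / 2)"
proof -
  have "- (x - \<mu>)\<^sup>2 / 2 = - x\<^sup>2 / 2 + (\<mu> * x - \<mu>\<^sup>2 / 2)"
    by (simp add: power2_eq_square field_simps)
  then show ?thesis
    by (simp add: normal_density_def exp_add[symmetric])
qed

text \<open>Expanding around \<open>\<tau>\<close> leaves a cross term
  \<open>(x - \<tau>) * (\<tau> - \<mu>)\<close>, which only helps when \<open>x\<close> lies beyond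
  \<open>\<tau>\<close> as seen from \<open>\<mu>\<close>. The sign condition covers upper tails
  (\<open>\<mu> \<le> \<tau> \<le> x\<close>) and lower tails
  (\<open>x \<le> \<tau> \<le> \<mu>\<close>) at once; both occur below.\<close>

lemma normal_density_le_tilt:
  assumes "0 \<le> (x - \<tau>) * (\<tau> - \<mu>)"
  shows "normal_density \<mu> 1 x \<le> exp (- (\<tau> - \<mu>)\<^sup>2 / 2) * normal_density \<tau> 1 x"
proof -
  have "- (x - \<mu>)\<^sup>2 / 2 = - (\<tau> - \<mu>)\<^sup>2 / 2 + - (x - \<tau>)\<^sup>2 / 2 - (x - \<tau>) * (\<tau> - \<mu>)"
    by (simp add: power2_eq_square field_simps)
  also have "\<dots> \<le> - (\<tau> - \<mu>)\<^sup>2 / 2 + - (x - \<tau>)\<^sup>2 / 2"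
    using assms by simp
  finally have "exp (- (x - \<mu>)\<^sup>2 / 2) \<le> exp (- (\<tau> - \<mu>)\<^sup>2 / 2 + - (x - \<tau>)\<^sup>2 / 2)"
    by (simp only: exp_le_cancel_iff)
  then have "exp (- (x - \<mu>)\<^sup>2 / 2) \<le> exp (- (\<tau> - \<mu>)\<^sup>2 / 2) * exp (- (x - \<tau>)\<^sup>2 / 2)"
    by (simp only: exp_add)
  then have "exp (- (x - \<mu>)\<^sup>2 / 2) / sqrt (2 * pi) \<le>
      exp (- (\<tau> - \<mu>)\<^sup>2 / 2) * exp (- (x - \<tau>)\<^sup>2 / 2) / sqrt (2 * pi)"
    by (intro divide_right_mono) auto
  then show ?thesis
    by (simp add: normal_density_def)
qed

lemma nn_integral_normal_density [simp]:
  "0 < \<sigma> \<Longrightarrow> (\<integral>\<^sup>+x. ennreal (normal_density \<mu> \<sigma> x) \<partial>lborel) = 1"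
  by (subst nn_integral_eq_integral) auto

lemma normal_set_nn_integral_le:
  assumes "\<And>x. x \<in> A \<Longrightarrow> 0 \<le> (x - \<tau>) * (\<tau> - \<mu>)"
  shows "(\<integral>\<^sup>+x. ennreal (normal_density \<mu> 1 x) * indicator A x \<partial>lborel)
    \<le> ennreal (exp (- (\<tau> - \<mu>)\<^sup>2 / 2))"
proof -
  have "(\<integral>\<^sup>+x. ennreal (normal_density \<mu> 1 x) * indicator A x \<partial>lborel) \<le>
     (\<integral>\<^sup>+x. ennreal (exp (- (\<tau> - \<mu>)\<^sup>2 / 2)) * ennreal (normal_density \<tau> 1 x) \<partial>lborel)"
    using normal_density_le_tilt[OF assms]
    by (intro nn_integral_mono) (auto simp: indicator_def simp flip: ennreal_mult)
  also have "\<dots> = ennreal (exp (- (\<tau> - \<mu>)\<^sup>2 / 2))"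
    by (subst nn_integral_cmult) auto
  finally show ?thesis .
qed

text \<open>Only the unit interval to the right of \<open>a\<close> is kept, and there the density
  is least at the right end. For \<open>a\<close> of order \<open>sqrt (ln n)\<close> the loss is
  subpolynomial in \<open>n\<close>.\<close>

lemma normal_tail_ge:
  assumes "\<mu> \<le> a"
  shows "ennreal (normal_density 0 1 (a + 1 - \<mu>)) \<le>
    (\<integral>\<^sup>+x. ennreal (normal_density \<mu> 1 x) * indicator {a<..} x \<partial>lborel)"
proof -
  have dens: "normal_density 0 1 (a + 1 - \<mu>) \<le> normal_density \<mu> 1 x" if "a < x" "x \<le> a + 1" for x
  proof -
    have "(x - \<mu>)\<^sup>2 \<le> (a + 1 - \<mu>)\<^sup>2"
      using that assms by (intro power_mono) auto
    then show ?thesis by (simp add: normal_density_def field_simps)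
  qed
  have "ennreal (normal_density 0 1 (a + 1 - \<mu>)) =
      (\<integral>\<^sup>+x. ennreal (normal_density 0 1 (a + 1 - \<mu>)) * indicator {a<..a+1} x \<partial>lborel)"
    by (subst nn_integral_cmult) auto
  also have "\<dots> \<le> (\<integral>\<^sup>+x. ennreal (normal_density \<mu> 1 x) * indicator {a<..} x \<partial>lborel)"
    by (intro nn_integral_mono) (auto simp: indicator_def dens)
  finally show ?thesis .
qed

lemma prob_space_std_normal: "prob_space std_normal"
  unfolding std_normal_def by (rule prob_space_normal_density) simp

lemma sets_std_normal [simp, measurable_cong]: "sets std_normal = sets borel"
  and space_std_normal [simp]: "space std_normal = UNIV"
  by (simp_all add: std_normal_def)

lemma sets_normal_mixture [simp, measurable_cong]: "sets (normal_mixture \<epsilon> \<mu>) = sets borel"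
  and space_normal_mixture [simp]: "space (normal_mixture \<epsilon> \<mu>) = UNIV"
  by (simp_all add: normal_mixture_def)

lemma emeasure_normal_mixture:
  assumes "A \<in> sets borel" "0 \<le> \<epsilon>" "\<epsilon> \<le> 1"
  shows "emeasure (normal_mixture \<epsilon> \<mu>) A = ennreal (1 - \<epsilon>) * emeasure std_normal A +
    ennreal \<epsilon> * (\<integral>\<^sup>+x. ennreal (normal_density \<mu> 1 x) * indicator A x \<partial>lborel)"
proof -
  have [measurable]: "A \<in> sets borel" by fact
  have "emeasure (normal_mixture \<epsilon> \<mu>) A =
    (\<integral>\<^sup>+x. ennreal (1 - \<epsilon>) * (ennreal (normal_density 0 1 x) * indicator A x) +
      ennreal \<epsilon> * (ennreal (normal_density \<mu> 1 x) * indicator A x) \<partial>lborel)"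
    unfolding normal_mixture_def using assms
    by (subst emeasure_density)
       (auto intro!: nn_integral_cong simp: indicator_def ennreal_mult)
  also have "\<dots> = ennreal (1 - \<epsilon>) * emeasure std_normal A +
    ennreal \<epsilon> * (\<integral>\<^sup>+x. ennreal (normal_density \<mu> 1 x) * indicator A x \<partial>lborel)"
    by (subst nn_integral_add) (auto simp: nn_integral_cmult std_normal_def emeasure_density)
  finally show ?thesis .
qed

lemma prob_space_normal_mixture:
  assumes "0 \<le> \<epsilon>" "\<epsilon> \<le> 1"
  shows "prob_space (normal_mixture \<epsilon> \<mu>)"
proof
  interpret N: prob_space std_normal by (rule prob_space_std_normal)
  show "emeasure (normal_mixture \<epsilon> \<mu>) (space (normal_mixture \<epsilon> \<mu>)) = 1"
    using assms N.emeasure_space_1 by (simp add: emeasure_normal_mixture flip: ennreal_plus)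
qed

lemma p_value_nn_integral:
  "ennreal (p_value x) = (\<integral>\<^sup>+z. ennreal (normal_density 0 1 z) * indicator {x<..} z \<partial>lborel)"
proof -
  interpret N: prob_space std_normal by (rule prob_space_std_normal)
  show ?thesis
    unfolding p_value_def by (subst N.emeasure_eq_measure[symmetric]) (simp add: std_normal_def emeasure_density)
qed

lemma p_value_antimono: "x \<le> y \<Longrightarrow> p_value y \<le> p_value x"
proof -
  interpret N: prob_space std_normal by (rule prob_space_std_normal)
  show "x \<le> y \<Longrightarrow> p_value y \<le> p_value x"
    unfolding p_value_def by (intro N.finite_measure_mono) auto
qed

lemma p_value_pos: "0 < p_value x"
proof -
  \<comment> \<open>The tail bound requires a threshold at or above the mean 0, hence
    \<open>max x 0\<close>.\<close>
  have "0 < normal_density 0 1 (max x 0 + 1)" by (simp add: normal_density_pos)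
  also have "ennreal (normal_density 0 1 (max x 0 + 1)) \<le> ennreal (p_value (max x 0))"
    using normal_tail_ge[of 0 "max x 0"] by (simp add: p_value_nn_integral)
  then have "normal_density 0 1 (max x 0 + 1) \<le> p_value (max x 0)"
    by (simp add: p_value_def)
  also have "\<dots> \<le> p_value x" by (rule p_value_antimono) simp
  finally show ?thesis .
qed

lemma p_value_le_1: "p_value x \<le> 1"
proof -
  interpret N: prob_space std_normal by (rule prob_space_std_normal)
  show ?thesis unfolding p_value_def by simp
qed

lemma p_value_le_exp: "0 \<le> x \<Longrightarrow> p_value x \<le> exp (- x\<^sup>2 / 2)"
proof -
  assume "0 \<le> x"
  then have "ennreal (p_value x) \<le> ennreal (exp (- (x - 0)\<^sup>2 / 2))"
    unfolding p_value_nn_integral by (intro normal_set_nn_integral_le) auto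
  then show ?thesis by simp
qed

lemma measurable_p_value [measurable]: "p_value \<in> borel_measurable borel"
proof -
  have "(\<lambda>x. - p_value x) \<in> borel_measurable borel"
    by (rule borel_measurable_mono) (auto simp: mono_def p_value_antimono)
  then have "(\<lambda>x. - (- p_value x)) \<in> borel_measurable borel"
    by (rule borel_measurable_uminus)
  then show ?thesis by simp
qed

text \<open>Under the null hypothesis p-values are stochastically no smaller than uniform, the
  direction that upper tail bounds use. By continuity of \<open>p_value\<close> the set is closed
  and contains its infimum \<open>y\<close>; it lies in \<open>{y..}\<close>, whose end point is a
  null set, and \<open>{y<..}\<close> has mass \<open>p_value y \<le> x\<close>.\<close>

lemma prob_p_value_le:
  assumes "0 \<le> x"
  shows "measure std_normal {z. p_value z \<le> x} \<le> x"
proof (cases "x < 1")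
  case True
  interpret N: prob_space std_normal by (rule prob_space_std_normal)
  interpret N: real_distribution std_normal by standard simp_all
  have null: "measure std_normal {y} = 0" for y
  proof -
    have "emeasure std_normal {y} = (\<integral>\<^sup>+z. ennreal (normal_density 0 1 z) * indicator {y} z \<partial>lborel)"
      by (simp add: std_normal_def emeasure_density)
    also have "\<dots> = 0" by (subst nn_integral_indicator_singleton) auto
    finally show ?thesis by (simp add: measure_def)
  qed
  have pc: "p_value y = 1 - cdf std_normal y" for y
    using N.prob_compl[of "{..y}"] by (simp add: p_value_def cdf_def Compl_eq_Diff_UNIV[symmetric])
  show ?thesis
  proof (cases "\<exists>z. p_value z \<le> x")
    case True
    then obtain b where b: "p_value b \<le> x" ..
    \<comment> \<open>Since \<open>x < 1\<close>, p-values exceed \<open>x\<close> far to the left,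
      so the set is bounded below and has an infimum.\<close>
    have "(cdf std_normal \<longlongrightarrow> 0) at_bot" by (rule N.cdf_lim_at_bot)
    then have "\<forall>\<^sub>F y in at_bot. cdf std_normal y < 1 - x"
      using \<open>x < 1\<close> by (intro order_tendstoD) auto
    then obtain a where a: "cdf std_normal a < 1 - x"
      by (metis (mono_tags, lifting) eventually_happens' trivial_limit_at_bot_linorder)
    define y where "y = Inf {z. p_value z \<le> x}"
    have bdd: "bdd_below {z. p_value z \<le> x}"
    proof (rule bdd_belowI)
      fix z assume "z \<in> {z. p_value z \<le> x}"
      then have "p_value z < p_value a" using a pc[of a] by auto
      then show "a \<le> z" using p_value_antimono[of z a] by linarith
    qed
    have "continuous_on UNIV p_value"
      unfolding pc[abs_def] using N.isCont_cdf null
      by (intro continuous_intros continuous_at_imp_continuous_on) auto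
    then have "closed {z. p_value z \<le> x}"
      by (intro closed_Collect_le) auto
    then have "y \<in> {z. p_value z \<le> x}"
      unfolding y_def using b bdd by (intro closed_contains_Inf) auto
    then have y: "p_value y \<le> x" by simp
    have "{z. p_value z \<le> x} \<subseteq> {y<..} \<union> {y}"
      using cInf_lower[OF _ bdd] by (force simp: y_def)
    then have "measure std_normal {z. p_value z \<le> x} \<le> measure std_normal ({y<..} \<union> {y})"
      by (intro N.finite_measure_mono) auto
    also have "\<dots> \<le> measure std_normal {y<..} + measure std_normal {y}"
      by (intro measure_Un_le) auto
    also have "\<dots> \<le> x" using y null by (simp add: p_value_def)
    finally show ?thesis .
  next
    case False
    then have "{z. p_value z \<le> x} = {}" by auto
    then show ?thesis using assms by simp
  qed
next
  case False
  interpret N: prob_space std_normal by (rule prob_space_std_normal)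
  show ?thesis using False N.prob_le_1[of "{z. p_value z \<le> x}"] by linarith
qed

subsection \<open>The statistic under the null hypothesis\<close>

text \<open>The relative entropy of Bernoulli(\<open>t\<close>) with respect to
  Bernoulli(\<open>x\<close>): the finite nonzero branch of \<open>Kplus\<close> as a real function,
  so that calculus applies.\<close>

definition kl :: "real \<Rightarrow> real \<Rightarrow> real" where
  "kl t x = t * ln (t / x) + (1 - t) * ln ((1 - t) / (1 - x))"

lemma kl_has_derivative:
  assumes "0 < x" "x < t" "t < 1"
  shows "(kl t has_real_derivative (x - t) / (x * (1 - x))) (at x)"
proof -
  have "((\<lambda>x. t * (ln t - ln x) + (1 - t) * (ln (1 - t) - ln (1 - x))) has_real_derivative
      t * (0 - 1 / x) + (1 - t) * (0 - (0 - 1) / (1 - x))) (at x)"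
    using assms by (auto intro!: derivative_eq_intros)
  also have "t * (0 - 1 / x) + (1 - t) * (0 - (0 - 1) / (1 - x)) = (x - t) / (x * (1 - x))"
    using assms by (simp add: divide_simps) (simp add: algebra_simps)
  finally show ?thesis
    by (rule has_field_derivative_transform_within_open[where S = "{0<..<1}"])
       (use assms in \<open>auto simp: kl_def ln_div\<close>)
qed

lemma continuous_on_kl:
  assumes "0 < a" "t < 1"
  shows "continuous_on {a..t} (kl t)"
  unfolding kl_def[abs_def] using assms by (intro continuous_intros) auto

lemma kl_refl: "0 < t \<Longrightarrow> t < 1 \<Longrightarrow> kl t t = 0"
  by (simp add: kl_def)

lemma kl_antimono:
  assumes "0 < x" "x \<le> y" "y \<le> t" "t < 1"
  shows "kl t y \<le> kl t x"
proof -
  have "\<exists>d. (kl t has_real_derivative d) (at u) \<and> d \<le> 0" if u: "x < u" "u < y" for u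
  proof -
    have "(kl t has_real_derivative (u - t) / (u * (1 - u))) (at u)"
      using assms u by (intro kl_has_derivative) auto
    moreover have "(u - t) / (u * (1 - u)) \<le> 0"
      using u assms by (intro divide_nonpos_pos mult_pos_pos) auto
    ultimately show ?thesis by blast
  qed
  moreover have "continuous_on {x..y} (kl t)"
    using assms by (intro continuous_on_subset[OF continuous_on_kl[of x t]]) auto
  ultimately show ?thesis
    using DERIV_nonpos_imp_decreasing_open[OF assms(2)] by blast
qed

text \<open>Both sides vanish at \<open>x = t\<close>, and their difference decreases in
  \<open>x\<close> because \<open>u * (1 - u) \<le> t\<close> makes the slope of \<open>kl\<close>
  the steeper one. The denominator \<open>t\<close> is essential: it tends to 0 in the application,
  where a bound of Pinsker type, without it, would be too weak.\<close>

lemma kl_ge: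
  assumes "0 < x" "x < t" "t < 1"
  shows "(t - x)\<^sup>2 / (2 * t) \<le> kl t x"
proof -
  define g where "g = (\<lambda>u. kl t u - (t - u)\<^sup>2 / (2 * t))"
  have "\<exists>d. (g has_real_derivative d) (at u) \<and> d \<le> 0" if u: "x < u" "u < t" for u
  proof -
    have "((\<lambda>u. (t - u)\<^sup>2 / (2 * t)) has_real_derivative (u - t) / t) (at u)"
      using assms by (auto intro!: derivative_eq_intros simp: field_simps)
    then have "(g has_real_derivative (u - t) / (u * (1 - u)) - (u - t) / t) (at u)"
      unfolding g_def using u assms by (intro DERIV_diff kl_has_derivative) auto
    moreover have "(u - t) / (u * (1 - u)) \<le> (u - t) / t"
    proof -
      have "u * (1 - u) \<le> t * 1" using u assms by (intro mult_mono) auto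
      then show ?thesis using u assms by (intro divide_left_mono_neg) auto
    qed
    ultimately show ?thesis
      by (intro exI conjI) auto
  qed
  moreover have "continuous_on {x..t} g"
    unfolding g_def using assms by (intro continuous_intros continuous_on_kl) auto
  ultimately have "g t \<le> g x"
    using assms(2) by (intro DERIV_nonpos_imp_decreasing_open[of x t g]) auto
  then show ?thesis using assms by (simp add: g_def kl_refl)
qed

lemma Kplus_eq: "0 < x \<Longrightarrow> x < t \<Longrightarrow> t < 1 \<Longrightarrow> Kplus t x = ereal (kl t x)"
  by (simp add: Kplus_def kl_def)

section \<open>Measurability and level sets of the statistic\<close>

lemma measurable_Kplus [measurable]: "Kplus t \<in> borel_measurable borel"
  unfolding Kplus_def[abs_def] by measurable

text \<open>Sorting is treated through its sublevel sets, which are events about counts.\<close>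

lemma measurable_sorted_p_value:
  assumes "i \<in> {1..n}" "sets M = sets borel"
  shows "(\<lambda>X. sorted_p_value n X i) \<in> borel_measurable (PiM {1..n} (\<lambda>_. M))"
proof -
  have "{X \<in> space (PiM {1..n} (\<lambda>_. M)). sorted_p_value n X i \<le> a} \<in> sets (PiM {1..n} (\<lambda>_. M))" for a
  proof -
    have "{z \<in> space borel. p_value z \<le> a} \<in> sets borel" by measurable
    then have "{z. p_value z \<le> a} \<in> sets M" by (simp only: assms(2) space_borel UNIV_I simp_thms)
    from sets_card_PiM[OF finite_atLeastAtMost this, of 1 n i] show ?thesis
      by (simp only: sorted_p_value_le_iff[OF assms(1)] mem_Collect_eq)
  qed
  then show ?thesis unfolding borel_measurable_iff_le by (rule allI)
qed

lemma measurable_BJ_plus: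
  assumes "sets M = sets borel"
  shows "BJ_plus n \<in> borel_measurable (PiM {1..n} (\<lambda>_. M))"
proof (cases "2 \<le> n")
  case True
  have *: "(\<lambda>X. Kplus (real i / real n) (sorted_p_value n X i)) \<in> borel_measurable (PiM {1..n} (\<lambda>_. M))"
    if "i \<in> {1..n div 2}" for i
    using that measurable_sorted_p_value[OF _ assms, of i n]
    by (intro measurable_compose[OF _ measurable_Kplus]) auto
  show ?thesis
    unfolding BJ_plus_def[abs_def] using True
    by (intro borel_measurable_ereal_times borel_measurable_const borel_measurable_Max *) auto
next
  case False
  \<comment> \<open>The maximum over the empty set is a fixed value, so the statistic is constant in
    \<open>X\<close>.\<close>
  then have "{1..n div 2} = {}" by simp
  then show ?thesis unfolding BJ_plus_def[abs_def] by simp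
qed

lemma ereal_mult_less_cancel_left_pos:
  fixes a b c :: ereal
  assumes "0 < a" "a < \<infinity>"
  shows "a * b < a * c \<longleftrightarrow> b < c"
  using assms by (cases a; cases b; cases c) auto

lemma ereal_less_BJ_plus_iff:
  assumes "2 \<le> n"
  shows "ereal c < BJ_plus n X \<longleftrightarrow>
    (\<exists>i\<in>{1..n div 2}. ereal (c / n) < Kplus (real i / real n) (sorted_p_value n X i))"
proof -
  have "ereal c = ereal (real n) * ereal (c / n)" using assms by simp
  then have "ereal c < BJ_plus n X \<longleftrightarrow>
     ereal (real n) * ereal (c / n) < ereal (real n) * (MAX i\<in>{1..n div 2}. Kplus (real i / real n) (sorted_p_value n X i))"
    by (simp add: BJ_plus_def)
  also have "\<dots> \<longleftrightarrow> ereal (c / n) < (MAX i\<in>{1..n div 2}. Kplus (real i / real n) (sorted_p_value n X i))"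
    using assms by (intro ereal_mult_less_cancel_left_pos) auto
  also have "\<dots> \<longleftrightarrow> (\<exists>i\<in>{1..n div 2}. ereal (c / n) < Kplus (real i / real n) (sorted_p_value n X i))"
    using assms by (subst Max_gr_iff) auto
  finally show ?thesis .
qed

text \<open>\<open>y\<close> minimises the Chernoff bound for the event that at least \<open>t n\<close> of \<open>n\<close> uniform variables are \<open>\<le> x\<close>.\<close>

lemma kl_chernoff:
  assumes "0 < x" "x < t" "t < 1" "real i = t * real n"
  defines "y \<equiv> t * (1 - x) / (x * (1 - t))"
  shows "(1 + x * (y - 1)) ^ n * y powr (- real i) = exp (- (real n * kl t x))"
proof -
  have y: "0 < y" using assms by (simp add: y_def)
  have b: "1 + x * (y - 1) = (1 - x) / (1 - t)"
    using assms unfolding y_def by (simp add: divide_simps) (simp add: algebra_simps)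
  have pos: "0 < (1 - x) / (1 - t)" using assms by simp
  have "(1 + x * (y - 1)) ^ n * y powr (- real i) =
      exp (real n * ln ((1 - x) / (1 - t)) + - real i * ln y)"
    unfolding b using y pos by (simp only: exp_add exp_of_nat_mult exp_ln) (simp add: powr_def)
  also have "ln y = ln (t / x) + ln ((1 - x) / (1 - t))"
    using assms by (simp add: y_def ln_mult ln_div)
  also have "real n * ln ((1 - x) / (1 - t)) + - real i * (ln (t / x) + ln ((1 - x) / (1 - t))) =
     - (real n * kl t x)"
    using assms by (simp add: kl_def ln_div algebra_simps)
  finally show ?thesis .
qed

text \<open>As \<open>kl t\<close> decreases on \<open>(0, t)\<close>, a large value means that the
  order statistic lies below the \<open>x\<close> with \<open>kl t x = c / n\<close>, that is, at
  least \<open>i\<close> p-values are \<open>\<le> x\<close>. The optimised Chernoff bound for this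
  count is \<open>exp (- n * kl t x)\<close>, exactly \<open>exp (- c)\<close>.\<close>

lemma H0_order_statistic_bound:
  assumes i: "i \<in> {1..n div 2}" and c: "0 < c"
  shows "measure (H0 n) {X \<in> space (H0 n). ereal (c / n) < Kplus (real i / real n) (sorted_p_value n X i)}
    \<le> exp (- c)"
proof -
  define t where "t = real i / real n"
  have n: "0 < n" and "i \<in> {1..n}" using i by auto
  have t: "0 < t" "t < 1" using i by (auto simp: t_def)
  let ?E = "{X \<in> space (H0 n). ereal (c / n) < Kplus t (sorted_p_value n X i)}"
  have mem: "0 < sorted_p_value n X i \<and> sorted_p_value n X i < t \<and> c / n < kl t (sorted_p_value n X i)"
    if "X \<in> ?E" for X
  proof -
    let ?u = "sorted_p_value n X i"
    \<comment> \<open>P-values lie in \<open>(0, 1]\<close>, which rules out the infinite branch of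
      \<open>Kplus\<close>; positivity of \<open>c\<close> rules out the zero branch.\<close>
    have u: "0 < ?u" "?u \<le> 1"
      using sorted_p_value_mem[OF \<open>i \<in> {1..n}\<close>, of X] p_value_pos p_value_le_1 by auto
    have "0 < ereal (c / n)" using c n by simp
    also have "\<dots> < Kplus t ?u" using that by simp
    finally have "?u < t" using u t by (auto simp: Kplus_def split: if_splits)
    then show ?thesis using that u t by (auto simp: Kplus_eq)
  qed
  show ?thesis
  \<comment> \<open>A witness \<open>u\<close> serves as left end point for the intermediate value
    theorem; without one the event is empty.\<close>
  proof (cases "\<exists>u. 0 < u \<and> u < t \<and> c / n < kl t u")
    case True
    then obtain u where u: "0 < u" "u < t" "c / n < kl t u" by auto
    have "\<exists>x. u \<le> x \<and> x \<le> t \<and> kl t x = c / n"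
      using u t c n by (intro IVT2' continuous_on_kl) (auto simp: kl_refl)
    then obtain x where x: "u \<le> x" "x \<le> t" "kl t x = c / n" by auto
    have "x \<noteq> t" using x(3) c n t by (auto simp: kl_refl)
    then have x01: "0 < x" "x < t" using u x by auto
    define A where "A = {z. p_value z \<le> x}"
    have A: "A \<in> sets std_normal" unfolding A_def sets_std_normal by measurable
    define y where "y = t * (1 - x) / (x * (1 - t))"
    have y: "1 \<le> y"
      using x01 t by (simp add: y_def field_simps)
    let ?F = "{X \<in> space (H0 n). i \<le> card {j \<in> {1..n}. X j \<in> A}}"
    have F: "?F \<in> sets (H0 n)"
      unfolding H0_def using A by (intro sets_card_PiM) auto
    interpret P: product_prob_space "\<lambda>_. std_normal" "{1..n}"
      by (intro product_prob_spaceI prob_space_std_normal)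
    have "?E \<subseteq> ?F"
    proof
      fix X assume X: "X \<in> ?E"
      from mem[OF this] have m: "0 < sorted_p_value n X i" "sorted_p_value n X i < t"
        "c / n < kl t (sorted_p_value n X i)" by auto
      have "sorted_p_value n X i \<le> x"
      proof (rule ccontr)
        assume "\<not> sorted_p_value n X i \<le> x"
        then have "kl t (sorted_p_value n X i) \<le> kl t x"
          using m x01 t by (intro kl_antimono) auto
        then show False using m x by simp
      qed
      then show "X \<in> ?F"
        using X sorted_p_value_le_iff[OF \<open>i \<in> {1..n}\<close>] by (simp add: A_def)
    qed
    then have "measure (H0 n) ?E \<le> measure (H0 n) ?F"
      using F unfolding H0_def by (rule P.finite_measure_mono)
    also have "\<dots> \<le> (1 + measure std_normal A * (y - 1)) ^ card {1..n} * y powr (- real i)"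
    proof -
      have "y powr real i \<le> y ^ card {j \<in> {1..n}. X j \<in> A}" if "X \<in> ?F" for X
        using that y by (simp add: powr_realpow power_increasing)
      then show ?thesis
        using F y A unfolding H0_def by (intro prob_card_le_chernoff prob_space_std_normal; simp)
    qed
    also have "\<dots> \<le> (1 + x * (y - 1)) ^ n * y powr (- real i)"
    proof -
      have "measure std_normal A * (y - 1) \<le> x * (y - 1)"
        using prob_p_value_le[of x] x01 y unfolding A_def by (intro mult_right_mono) auto
      moreover have "0 \<le> measure std_normal A * (y - 1)" using y by simp
      ultimately show ?thesis
        by (simp only: card_atLeastAtMost diff_Suc_1) (intro mult_right_mono power_mono; simp)
    qed
    also have "\<dots> = exp (- (real n * kl t x))"
      unfolding y_def using x01 t n by (intro kl_chernoff) (auto simp: t_def)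
    also have "real n * kl t x = c" using x n by simp
    finally show ?thesis by (simp add: t_def)
  next
    case False
    then have "?E = {}" using mem by blast
    then show ?thesis by (simp only: t_def[symmetric]) simp
  qed
qed

lemma H0_BJ_plus_bound:
  assumes "2 \<le> n" "0 < c"
  shows "measure (H0 n) {X \<in> space (H0 n). ereal c < BJ_plus n X} \<le> real n * exp (- c)"
proof -
  interpret P: product_prob_space "\<lambda>_. std_normal" "{1..n}"
    by (intro product_prob_spaceI prob_space_std_normal)
  let ?E = "\<lambda>i. {X \<in> space (H0 n). ereal (c / n) < Kplus (real i / real n) (sorted_p_value n X i)}"
  have meas: "?E i \<in> sets (H0 n)" if "i \<in> {1..n div 2}" for i
  proof -
    have "(\<lambda>X. sorted_p_value n X i) \<in> borel_measurable (H0 n)"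
      unfolding H0_def using that by (intro measurable_sorted_p_value) auto
    then show ?thesis by measurable
  qed
  have "{X \<in> space (H0 n). ereal c < BJ_plus n X} = (\<Union>i\<in>{1..n div 2}. ?E i)"
    using ereal_less_BJ_plus_iff[OF assms(1)] by auto
  then have "measure (H0 n) {X \<in> space (H0 n). ereal c < BJ_plus n X} \<le> (\<Sum>i\<in>{1..n div 2}. measure (H0 n) (?E i))"
    using meas by (simp only:) (intro measure_UNION_le, auto)
  also have "\<dots> \<le> (\<Sum>i\<in>{1..n div 2}. exp (- c))"
    using assms by (intro sum_mono H0_order_statistic_bound) auto
  also have "\<dots> \<le> real n * exp (- c)"
    by (auto intro!: mult_right_mono)
  finally show ?thesis .
qed

section \<open>Critical values and their level\<close>

lemma critical_value_le:
  "measure (H0 n) {X \<in> space (H0 n). c < T n X} \<le> \<alpha> \<Longrightarrow> critical_value T n \<alpha> \<le> c"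
  unfolding critical_value_def by (rule Inf_lower) simp

text \<open>A decreasing sequence of admissible values approaches the infimum; its rejection events
  increase to the one at the infimum, and continuity from below passes the level to the
  limit.\<close>

lemma critical_value_attained:
  assumes T: "T n \<in> borel_measurable (H0 n)" and "0 \<le> \<alpha>"
  shows "measure (H0 n) {X \<in> space (H0 n). critical_value T n \<alpha> < T n X} \<le> \<alpha>"
proof -
  interpret P: product_prob_space "\<lambda>_. std_normal" "{1..n}"
    by (intro product_prob_spaceI prob_space_std_normal)
  let ?C = "{c. measure (H0 n) {X \<in> space (H0 n). T n X > c} \<le> \<alpha>}"
  have "\<infinity> \<in> ?C" using assms(2) by simp
  then have "?C \<noteq> {}" by blast
  from Inf_countable_INF[OF this] obtain f
    where f: "decseq f" "range f \<subseteq> ?C" "Inf ?C = (INF i. f i)"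
    by (elim exE conjE)
  let ?E = "\<lambda>k. {X \<in> space (H0 n). f k < T n X}"
  have "?E k \<in> sets (H0 n)" for k
    using T by measurable
  moreover have "?E k \<subseteq> ?E l" if "k \<le> l" for k l
    using decseqD[OF f(1) that] by (auto intro: le_less_trans)
  then have "incseq ?E"
    by (simp only: incseq_def) blast
  ultimately have "(\<lambda>k. measure (H0 n) (?E k)) \<longlonglongrightarrow> measure (H0 n) (\<Union>k. ?E k)"
    unfolding H0_def by (intro P.finite_Lim_measure_incseq image_subsetI) 
  moreover have "(\<Union>k. ?E k) = {X \<in> space (H0 n). critical_value T n \<alpha> < T n X}"
    unfolding critical_value_def f(3) by (auto simp: INF_less_iff)
  moreover have "measure (H0 n) (?E k) \<le> \<alpha>" for k
    using f(2) by auto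
  ultimately show ?thesis
    by (auto intro: LIMSEQ_le_const2)
qed

subsection \<open>Truncated likelihood ratios\<close>

lemma PiM_density:
  assumes "prob_space M" "prob_space (density M f)" "f \<in> borel_measurable M" "finite I"
  shows "PiM I (\<lambda>_. density M f) = density (PiM I (\<lambda>_. M)) (\<lambda>X. \<Prod>i\<in>I. f (X i))"
proof -
  interpret M: prob_space M by fact
  interpret D: prob_space "density M f" by fact
  interpret P: product_sigma_finite "\<lambda>_. M" ..
  interpret Q: product_sigma_finite "\<lambda>_. density M f" ..
  note assms(3)[measurable]
  show ?thesis
  proof (rule Q.PiM_eqI[symmetric])
    show "sets (density (PiM I (\<lambda>_. M)) (\<lambda>X. \<Prod>i\<in>I. f (X i))) = sets (PiM I (\<lambda>_. density M f))"
      by (simp cong: sets_PiM_cong)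
  next
    fix A assume "\<And>i. i \<in> I \<Longrightarrow> A i \<in> sets (density M f)"
    then have A[measurable]: "\<And>i. i \<in> I \<Longrightarrow> A i \<in> sets M" by simp
    have PA: "Pi\<^sub>E I A \<in> sets (PiM I (\<lambda>_. M))"
      using A assms(4) by (intro sets_PiM_I_finite) auto
    have "emeasure (density (PiM I (\<lambda>_. M)) (\<lambda>X. \<Prod>i\<in>I. f (X i))) (Pi\<^sub>E I A) =
       (\<integral>\<^sup>+X. (\<Prod>i\<in>I. f (X i)) * indicator (Pi\<^sub>E I A) X \<partial>PiM I (\<lambda>_. M))"
      using PA by (subst emeasure_density) auto
    also have "\<dots> = (\<integral>\<^sup>+X. (\<Prod>i\<in>I. f (X i) * indicator (A i) (X i)) \<partial>PiM I (\<lambda>_. M))"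
    proof (intro nn_integral_cong)
      fix X assume X: "X \<in> space (PiM I (\<lambda>_. M))"
      show "(\<Prod>i\<in>I. f (X i)) * indicator (Pi\<^sub>E I A) X = (\<Prod>i\<in>I. f (X i) * indicator (A i) (X i))"
      proof (cases "X \<in> Pi\<^sub>E I A")
        case True
        then have "\<And>i. i \<in> I \<Longrightarrow> X i \<in> A i" by (auto simp: PiE_iff)
        then show ?thesis using True by (auto intro!: prod.cong)
      next
        case False
        then obtain i where "i \<in> I" "X i \<notin> A i"
          using X by (auto simp: space_PiM PiE_iff)
        then have "\<exists>i\<in>I. f (X i) * indicator (A i) (X i) = 0" by (auto simp: indicator_def)
        then show ?thesis using False assms(4) by (simp add: prod_zero)
      qed
    qed
    also have "\<dots> = (\<Prod>i\<in>I. (\<integral>\<^sup>+x. f x * indicator (A i) x \<partial>M))"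
      using assms(4) by (intro P.product_nn_integral_prod) auto
    also have "\<dots> = (\<Prod>i\<in>I. emeasure (density M f) (A i))"
      by (intro prod.cong) (auto simp: emeasure_density)
    finally show "emeasure (density (PiM I (\<lambda>_. M)) (\<lambda>X. \<Prod>i\<in>I. f (X i))) (Pi\<^sub>E I A) =
      (\<Prod>i\<in>I. emeasure (density M f) (A i))" .
  qed fact
qed

text \<open>The likelihood ratio \<open>F\<close> is split as \<open>G + (F - G)\<close>, with
  \<open>G\<close> the product of truncated factors. On \<open>G\<close>, Cauchy--Schwarz against
  the indicator of \<open>A\<close> applies; \<open>F - G\<close> is bounded by its total mass
  \<open>1 - (1 - s)^n \<le> n * s\<close> (Bernoulli). Truncating each factor separately keeps the
  product form, so both moments of \<open>G\<close> factorise.\<close>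

lemma PiM_density_prob_le:
  fixes s v :: real
  assumes "prob_space M" "prob_space (density M f)"
    and f: "f \<in> borel_measurable M" and g: "g \<in> borel_measurable M"
    and gf: "\<And>x. g x \<le> f x"
    and s: "0 \<le> s" "s \<le> 1" "ennreal (1 - s) \<le> (\<integral>\<^sup>+x. g x \<partial>M)"
    and v: "0 \<le> v" "(\<integral>\<^sup>+x. (g x)\<^sup>2 \<partial>M) \<le> ennreal v"
    and I: "finite I" and A: "A \<in> sets (PiM I (\<lambda>_. M))"
  shows "measure (PiM I (\<lambda>_. density M f)) A
    \<le> sqrt (measure (PiM I (\<lambda>_. M)) A * v ^ card I) + real (card I) * s"
proof -
  interpret M: prob_space M by fact
  interpret D: prob_space "density M f" by fact
  interpret P: product_prob_space "\<lambda>_. M" I ..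
  interpret Q: product_prob_space "\<lambda>_. density M f" I ..
  note f[measurable] g[measurable] A[measurable]
  let ?P = "PiM I (\<lambda>_. M)" and ?Q = "PiM I (\<lambda>_. density M f)"
  define F where "F X = (\<Prod>i\<in>I. f (X i))" for X
  define G where "G X = (\<Prod>i\<in>I. g (X i))" for X
  have Fm[measurable]: "F \<in> borel_measurable ?P" and Gm[measurable]: "G \<in> borel_measurable ?P"
    unfolding F_def[abs_def] G_def[abs_def] by measurable
  have GF: "G X \<le> F X" for X
    unfolding F_def G_def using I by (induction I rule: finite_induct) (auto intro!: mult_mono gf)
  have "(\<integral>\<^sup>+x. f x \<partial>M) = emeasure (density M f) (space M)"
    by (simp add: emeasure_density nn_integral_set_ennreal cong: nn_integral_cong)
  then have f1: "(\<integral>\<^sup>+x. f x \<partial>M) = 1"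
    using D.emeasure_space_1 by simp
  have F1: "(\<integral>\<^sup>+X. F X \<partial>?P) = 1"
    unfolding F_def by (subst P.product_nn_integral_prod) (auto simp: I f1)
  have G1: "(\<integral>\<^sup>+X. G X \<partial>?P) = (\<integral>\<^sup>+x. g x \<partial>M) ^ card I"
    unfolding G_def by (subst P.product_nn_integral_prod) (auto simp: I)
  have G2: "(\<integral>\<^sup>+X. (G X)\<^sup>2 \<partial>?P) = (\<integral>\<^sup>+x. (g x)\<^sup>2 \<partial>M) ^ card I"
    unfolding G_def prod_power_distrib by (subst P.product_nn_integral_prod) (auto simp: I)
  have Gfin: "(\<integral>\<^sup>+X. G X \<partial>?P) \<le> 1"
    using nn_integral_mono[of ?P G F] GF F1 by simp
  have "1 + real (card I) * (- s) \<le> (1 + (- s)) ^ card I"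
    using s by (intro Bernoulli_inequality) auto
  then have bern: "1 - (1 - s) ^ card I \<le> real (card I) * s" by simp
  have "(\<integral>\<^sup>+X. F X - G X \<partial>?P) = (\<integral>\<^sup>+X. F X \<partial>?P) - (\<integral>\<^sup>+X. G X \<partial>?P)"
    using Gfin by (intro nn_integral_diff) (auto simp: GF top_unique)
  also have "\<dots> \<le> 1 - ennreal (1 - s) ^ card I"
    unfolding F1 G1 using s by (intro ennreal_minus_mono power_mono) auto
  also have "\<dots> = ennreal (1 - (1 - s) ^ card I)"
    using s by (simp add: ennreal_power ennreal_minus power_le_one flip: ennreal_1)
  also have "\<dots> \<le> ennreal (real (card I) * s)"
    using bern by (rule ennreal_leI)
  finally have diff: "(\<integral>\<^sup>+X. F X - G X \<partial>?P) \<le> ennreal (real (card I) * s)" .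
  have "(\<integral>\<^sup>+X. G X * indicator A X \<partial>?P)\<^sup>2 \<le> (\<integral>\<^sup>+X. (G X)\<^sup>2 \<partial>?P) * (\<integral>\<^sup>+X. (indicator A X)\<^sup>2 \<partial>?P)"
    by (intro Cauchy_Schwarz_nn_integral) measurable
  also have "(\<integral>\<^sup>+X. (indicator A X)\<^sup>2 \<partial>?P) = ennreal (measure ?P A)"
  proof -
    have "(\<integral>\<^sup>+X. (indicator A X)\<^sup>2 \<partial>?P) = (\<integral>\<^sup>+X. indicator A X \<partial>?P)"
      by (intro nn_integral_cong) (simp add: indicator_def)
    then show ?thesis by (simp add: P.emeasure_eq_measure)
  qed
  also have "(\<integral>\<^sup>+X. (G X)\<^sup>2 \<partial>?P) \<le> ennreal v ^ card I"
    unfolding G2 using v by (intro power_mono) auto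
  also have "ennreal v ^ card I * ennreal (measure ?P A) = ennreal (measure ?P A * v ^ card I)"
    using v by (simp add: ennreal_power ennreal_mult mult.commute)
  finally have sq: "(\<integral>\<^sup>+X. G X * indicator A X \<partial>?P)\<^sup>2 \<le> ennreal (measure ?P A * v ^ card I)"
    by (simp add: mult_right_mono)
  \<comment> \<open>Taking the square root in \<open>ennreal\<close> requires excluding an infinite
    integral, which the finite bound \<open>sq\<close> does.\<close>
  have GA: "(\<integral>\<^sup>+X. G X * indicator A X \<partial>?P) \<le> ennreal (sqrt (measure ?P A * v ^ card I))"
  proof (cases "\<integral>\<^sup>+X. G X * indicator A X \<partial>?P" rule: ennreal_cases)
    case (real a)
    then show ?thesis using sq v by (simp add: ennreal_power real_le_rsqrt)
  next
    case top
    then show ?thesis using sq by (simp add: top_unique)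
  qed
  have "ennreal (measure ?Q A) = emeasure ?Q A"
    by (simp add: Q.emeasure_eq_measure)
  also have "\<dots> = (\<integral>\<^sup>+X. F X * indicator A X \<partial>?P)"
    by (simp add: PiM_density[OF assms(1,2) f I] emeasure_density F_def)
  also have "\<dots> \<le> (\<integral>\<^sup>+X. G X * indicator A X + (F X - G X) \<partial>?P)"
  proof (intro nn_integral_mono)
    fix X
    show "F X * indicator A X \<le> G X * indicator A X + (F X - G X)"
      using ennreal_minus_le_iff[of "F X" "G X" "F X - G X"] by (simp add: indicator_def)
  qed
  also have "\<dots> = (\<integral>\<^sup>+X. G X * indicator A X \<partial>?P) + (\<integral>\<^sup>+X. F X - G X \<partial>?P)"
    by (intro nn_integral_add) auto
  also have "\<dots> \<le> ennreal (sqrt (measure ?P A * v ^ card I)) + ennreal (real (card I) * s)"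
    by (intro add_mono GA diff)
  also have "\<dots> = ennreal (sqrt (measure ?P A * v ^ card I) + real (card I) * s)"
    using s v by (simp add: ennreal_plus)
  finally show ?thesis
    using s v by (subst (asm) ennreal_le_iff) auto
qed

lemma normal_mixture_eq_density:
  assumes "0 \<le> \<epsilon>" "\<epsilon> \<le> 1"
  shows "normal_mixture \<epsilon> \<mu> = density std_normal (\<lambda>x. ennreal (1 - \<epsilon> + \<epsilon> * exp (\<mu> * x - \<mu>\<^sup>2 / 2)))"
proof -
  have "(1 - \<epsilon>) * normal_density 0 1 x + \<epsilon> * normal_density \<mu> 1 x =
      normal_density 0 1 x * (1 - \<epsilon> + \<epsilon> * exp (\<mu> * x - \<mu>\<^sup>2 / 2))" for x
    by (simp add: normal_density_tilt[of \<mu>] algebra_simps)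
  then show ?thesis
    unfolding normal_mixture_def std_normal_def using assms
    by (subst density_density_eq) (auto intro!: density_cong simp: ennreal_mult')
qed

lemma nn_integral_std_normal:
  "h \<in> borel_measurable borel \<Longrightarrow>
    (\<integral>\<^sup>+x. h x \<partial>std_normal) = (\<integral>\<^sup>+x. ennreal (normal_density 0 1 x) * h x \<partial>lborel)"
  unfolding std_normal_def by (intro nn_integral_density) auto

text \<open>Here \<open>V\<close> bounds the second moment of the signal likelihood ratio restricted
  to \<open>x \<le> \<tau>\<close>, and the last summand bounds the expected number of signals above
  \<open>\<tau>\<close>.\<close>

lemma normal_mixture_prob_le:
  assumes \<epsilon>: "0 \<le> \<epsilon>" "\<epsilon> \<le> 1" and "\<mu> \<le> \<tau>"
    and V: "0 \<le> V" "ennreal (exp (\<mu>\<^sup>2)) * (\<integral>\<^sup>+x. ennreal (normal_density (2 * \<mu>) 1 x) * indicator {..\<tau>} x \<partial>lborel) \<le> ennreal V"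
    and A: "A \<in> sets (PiM {1..n} (\<lambda>_. std_normal))"
  shows "measure (PiM {1..n} (\<lambda>_. normal_mixture \<epsilon> \<mu>)) A
    \<le> sqrt (measure (PiM {1..n} (\<lambda>_. std_normal)) A * exp (real n * \<epsilon>\<^sup>2 * V))
      + real n * (\<epsilon> * exp (- (\<tau> - \<mu>)\<^sup>2 / 2))"
proof -
  interpret N: prob_space std_normal by (rule prob_space_std_normal)
  let ?e = "\<lambda>x. exp (\<mu> * x - \<mu>\<^sup>2 / 2)"
  let ?f = "\<lambda>x. ennreal (1 - \<epsilon> + \<epsilon> * ?e x)"
  \<comment> \<open>Only the signal term is truncated, so the removed mass carries the factor
    \<open>\<epsilon>\<close>.\<close>
  let ?g = "\<lambda>x. ennreal (1 - \<epsilon> + \<epsilon> * (?e x * indicat_real {..\<tau>} x))"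
  let ?s = "\<epsilon> * exp (- (\<tau> - \<mu>)\<^sup>2 / 2)"
  let ?v = "1 + \<epsilon>\<^sup>2 * V"
  have e1: "(\<integral>\<^sup>+x. ennreal (?e x) * indicator B x \<partial>std_normal) =
    (\<integral>\<^sup>+x. ennreal (normal_density \<mu> 1 x) * indicator B x \<partial>lborel)" if [measurable]: "B \<in> sets borel" for B
    by (subst nn_integral_std_normal)
       (auto intro!: nn_integral_cong simp: normal_density_tilt[of \<mu>] ennreal_mult mult.assoc)
  have e2: "(\<integral>\<^sup>+x. ennreal ((?e x)\<^sup>2) * indicator {..\<tau>} x \<partial>std_normal) =
    ennreal (exp (\<mu>\<^sup>2)) * (\<integral>\<^sup>+x. ennreal (normal_density (2 * \<mu>) 1 x) * indicator {..\<tau>} x \<partial>lborel)"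
  proof -
    \<comment> \<open>Squaring the likelihood ratio doubles the tilt: the squared ratio times the
      null density is a multiple of the normal density with mean \<open>2 * \<mu>\<close>.\<close>
    have "(?e x)\<^sup>2 = exp (2 * \<mu> * x - (2 * \<mu>)\<^sup>2 / 2) * exp (\<mu>\<^sup>2)" for x
      by (simp add: power2_eq_square exp_add[symmetric] algebra_simps)
    then have "normal_density 0 1 x * (?e x)\<^sup>2 = exp (\<mu>\<^sup>2) * normal_density (2 * \<mu>) 1 x" for x
      by (simp add: normal_density_tilt[of "2 * \<mu>"])
    then have "ennreal (normal_density 0 1 x) * ennreal ((?e x)\<^sup>2) = ennreal (exp (\<mu>\<^sup>2)) * ennreal (normal_density (2 * \<mu>) 1 x)" for x
      by (simp flip: ennreal_mult)
    then have "ennreal (normal_density 0 1 x) * (ennreal ((?e x)\<^sup>2) * indicator {..\<tau>} x) =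
      ennreal (exp (\<mu>\<^sup>2)) * (ennreal (normal_density (2 * \<mu>) 1 x) * indicator {..\<tau>} x)" for x
      by (simp add: mult.assoc[symmetric])
    then show ?thesis
      by (subst nn_integral_std_normal) (auto simp: nn_integral_cmult)
  qed
  have s1: "?s \<le> 1"
    using \<epsilon> by (intro mult_le_one) auto
  have low: "ennreal (1 - ?s) \<le> (\<integral>\<^sup>+x. ?g x \<partial>std_normal)"
  proof -
    have "1 = (\<integral>\<^sup>+x. ?f x \<partial>std_normal)"
      using prob_space.emeasure_space_1[OF prob_space_normal_mixture[OF \<epsilon>], of \<mu>]
      by (simp add: normal_mixture_eq_density[OF \<epsilon>] emeasure_density)
    also have "\<dots> = (\<integral>\<^sup>+x. ?g x + ennreal \<epsilon> * (ennreal (?e x) * indicator {\<tau><..} x) \<partial>std_normal)"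
      using \<epsilon> by (intro nn_integral_cong) (auto simp: indicator_def simp flip: ennreal_mult ennreal_plus)
    also have "\<dots> = (\<integral>\<^sup>+x. ?g x \<partial>std_normal) +
        ennreal \<epsilon> * (\<integral>\<^sup>+x. ennreal (normal_density \<mu> 1 x) * indicator {\<tau><..} x \<partial>lborel)"
      by (subst nn_integral_add) (auto simp: nn_integral_cmult e1)
    also have "\<dots> \<le> (\<integral>\<^sup>+x. ?g x \<partial>std_normal) + ennreal \<epsilon> * ennreal (exp (- (\<tau> - \<mu>)\<^sup>2 / 2))"
      using \<open>\<mu> \<le> \<tau>\<close> by (intro add_mono mult_left_mono normal_set_nn_integral_le) auto
    also have "\<dots> = (\<integral>\<^sup>+x. ?g x \<partial>std_normal) + ennreal ?s"
      using \<epsilon> by (simp add: ennreal_mult)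
    finally have "1 \<le> (\<integral>\<^sup>+x. ?g x \<partial>std_normal) + ennreal ?s" .
    then have "1 - ennreal ?s \<le> (\<integral>\<^sup>+x. ?g x \<partial>std_normal)"
      by (simp add: ennreal_minus_le_iff add.commute)
    then show ?thesis
      using \<epsilon> s1 by (simp add: ennreal_minus flip: ennreal_1)
  qed
  have up: "(\<integral>\<^sup>+x. (?g x)\<^sup>2 \<partial>std_normal) \<le> ennreal ?v"
  proof -
    have "(?g x)\<^sup>2 \<le> ennreal ((1 - \<epsilon>)\<^sup>2) + ennreal (2 * (1 - \<epsilon>) * \<epsilon>) * ennreal (?e x)
        + ennreal (\<epsilon>\<^sup>2) * (ennreal ((?e x)\<^sup>2) * indicator {..\<tau>} x)" for x
      using \<epsilon> by (auto simp: indicator_def ennreal_power power2_sum power_mult_distrib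
          simp flip: ennreal_mult ennreal_plus) 
    then have "(\<integral>\<^sup>+x. (?g x)\<^sup>2 \<partial>std_normal) \<le>
      (\<integral>\<^sup>+x. ennreal ((1 - \<epsilon>)\<^sup>2) + ennreal (2 * (1 - \<epsilon>) * \<epsilon>) * ennreal (?e x)
        + ennreal (\<epsilon>\<^sup>2) * (ennreal ((?e x)\<^sup>2) * indicator {..\<tau>} x) \<partial>std_normal)"
      by (intro nn_integral_mono)
    also have "\<dots> = ennreal ((1 - \<epsilon>)\<^sup>2) + ennreal (2 * (1 - \<epsilon>) * \<epsilon>) * (\<integral>\<^sup>+x. ennreal (?e x) \<partial>std_normal)
        + ennreal (\<epsilon>\<^sup>2) * (\<integral>\<^sup>+x. ennreal ((?e x)\<^sup>2) * indicator {..\<tau>} x \<partial>std_normal)"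
      using N.emeasure_space_1 by (simp add: nn_integral_add nn_integral_cmult)
    also have "(\<integral>\<^sup>+x. ennreal (?e x) \<partial>std_normal) = 1"
      using e1[of UNIV] by simp
    also have "ennreal (\<epsilon>\<^sup>2) * (\<integral>\<^sup>+x. ennreal ((?e x)\<^sup>2) * indicator {..\<tau>} x \<partial>std_normal) \<le> ennreal (\<epsilon>\<^sup>2) * ennreal V"
      unfolding e2 by (intro mult_left_mono V) simp
    also have "ennreal ((1 - \<epsilon>)\<^sup>2) + ennreal (2 * (1 - \<epsilon>) * \<epsilon>) * 1 + ennreal (\<epsilon>\<^sup>2) * ennreal V
        = ennreal ((1 - \<epsilon>)\<^sup>2 + 2 * (1 - \<epsilon>) * \<epsilon> + \<epsilon>\<^sup>2 * V)"
      using \<epsilon> V by (simp flip: ennreal_mult ennreal_plus)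
    also have "\<dots> \<le> ennreal ?v"
    proof (rule ennreal_leI)
      \<comment> \<open>The terms linear in \<open>\<epsilon>\<close> cancel. A remainder of order
        \<open>\<epsilon>\<close> would ruin the bound after raising it to the power
        \<open>n\<close>.\<close>
      have "(1 - \<epsilon>)\<^sup>2 + 2 * (1 - \<epsilon>) * \<epsilon> = 1 - \<epsilon>\<^sup>2" by (simp add: power2_eq_square algebra_simps)
      then show "(1 - \<epsilon>)\<^sup>2 + 2 * (1 - \<epsilon>) * \<epsilon> + \<epsilon>\<^sup>2 * V \<le> ?v" by simp
    qed
    finally show ?thesis by simp
  qed
  have "measure (PiM {1..n} (\<lambda>_. density std_normal ?f)) A
    \<le> sqrt (measure (PiM {1..n} (\<lambda>_. std_normal)) A * ?v ^ card {1..n}) + real (card {1..n}) * ?s"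
  proof (rule PiM_density_prob_le)
    show "prob_space (density std_normal ?f)"
      using prob_space_normal_mixture[OF \<epsilon>, of \<mu>] by (simp add: normal_mixture_eq_density[OF \<epsilon>])
    show "?g x \<le> ?f x" for x
      using \<epsilon> by (auto simp: indicator_def intro!: ennreal_leI)
  qed (use \<epsilon> V s1 low up A prob_space_std_normal in auto)
  also have "?v ^ card {1..n} \<le> exp (real n * \<epsilon>\<^sup>2 * V)"
  proof -
    have "?v ^ n \<le> exp (\<epsilon>\<^sup>2 * V) ^ n"
      using V exp_ge_add_one_self[of "\<epsilon>\<^sup>2 * V"] by (intro power_mono) auto
    then show ?thesis by (simp add: exp_of_nat_mult[symmetric] mult.assoc)
  qed
  finally show ?thesis
    by (simp add: normal_mixture_eq_density[OF \<epsilon>] mult_left_mono)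
qed

subsection \<open>The detection boundary\<close>

text \<open>With \<open>k\<close> the least integer above \<open>n * (p + d)\<close>, the count
  forces the \<open>k\<close>-th order statistic below \<open>p\<close> while
  \<open>k / n \<ge> p + d\<close>; \<open>kl_ge\<close> then applies at this single index. The term
  \<open>1 / n\<close> in \<open>half\<close> pays for rounding up, so that
  \<open>k \<le> n div 2\<close>.\<close>

lemma BJ_plus_gt_of_count:
  assumes "2 \<le> n" "0 < d" and p: "p = p_value \<tau>" and half: "p + d + 1 / n \<le> 1 / 2"
    and c: "c < n * d\<^sup>2 / (2 * (p + d))"
    and count: "real n * (p + d) \<le> card {j\<in>{1..n}. X j \<in> {\<tau><..}}"
  shows "ereal c < BJ_plus n X"
proof -
  define k where "k = nat \<lceil>real n * (p + d)\<rceil>"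
  define t where "t = real k / real n"
  define u where "u = sorted_p_value n X k"
  have p0: "0 < p" using p_value_pos p by simp
  have n0: "0 < real n" using assms(1) by simp
  have m0: "0 < real n * (p + d)" using n0 p0 assms(2) by simp
  then have "0 < \<lceil>real n * (p + d)\<rceil>" by (simp only: zero_less_ceiling)
  then have k1: "1 \<le> k" unfolding k_def by linarith
  have kl: "real n * (p + d) \<le> k" "k < real n * (p + d) + 1"
    using m0 unfolding k_def by linarith+
  have "real n * (p + d + 1 / n) \<le> real n * (1 / 2)"
    using half n0 by (intro mult_left_mono) auto
  then have "real n * (p + d) + 1 \<le> real n / 2" using n0 by (simp add: algebra_simps)
  with kl have "k \<le> n div 2" by linarith
  then have kn: "k \<in> {1..n div 2}" "k \<in> {1..n}" using k1 by auto
  have t: "p + d \<le> t" "t < 1"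
  proof -
    show "p + d \<le> t" using kl(1) n0 by (simp add: t_def field_simps)
    show "t < 1" using kn n0 by (auto simp: t_def)
  qed
  have "k \<le> card {j\<in>{1..n}. X j \<in> {\<tau><..}}"
    using count by (simp add: k_def nat_le_iff ceiling_le_iff)
  also have "\<dots> \<le> card {j\<in>{1..n}. p_value (X j) \<le> p}"
    unfolding p by (intro card_mono) (auto intro: p_value_antimono)
  finally have u: "u \<le> p"
    unfolding u_def using sorted_p_value_le_iff[OF kn(2)] by simp
  have u0: "0 < u"
    using sorted_p_value_mem[OF kn(2), of X] p_value_pos by (auto simp: u_def)
  \<comment> \<open>\<open>(t - p)^2 / t\<close> increases in \<open>t\<close> for
    \<open>t \<ge> p\<close>, so rounding up does no harm.\<close>
  have "d\<^sup>2 / (2 * (p + d)) \<le> (t - p)\<^sup>2 / (2 * t)"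
  proof -
    define h where "h = t - p - d"
    have h: "0 \<le> h" "t = p + d + h" using t by (auto simp: h_def)
    have "d\<^sup>2 * (p + d + h) \<le> (d + h)\<^sup>2 * (p + d)"
    proof -
      have "(d + h)\<^sup>2 * (p + d) - d\<^sup>2 * (p + d + h) = 2 * d * h * p + d\<^sup>2 * h + h\<^sup>2 * (p + d)"
        by (simp add: power2_eq_square algebra_simps)
      also have "\<dots> \<ge> 0" using h p0 assms(2) by simp
      finally show ?thesis by simp
    qed
    then have "d\<^sup>2 / (p + d) \<le> (d + h)\<^sup>2 / (p + d + h)"
      using h p0 assms(2) by (subst frac_le_eq) (auto simp: divide_le_0_iff mult.commute)
    moreover have "t - p = d + h" using h by simp
    ultimately show ?thesis
      using h(2) divide_right_mono[of "d\<^sup>2 / (p + d)" "(d + h)\<^sup>2 / (p + d + h)" 2] by (simp add: mult.commute)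
  qed
  also have "\<dots> \<le> (t - u)\<^sup>2 / (2 * t)"
    using u t p0 assms(2) by (intro divide_right_mono power_mono) auto
  also have "\<dots> \<le> kl t u"
    using u0 u t assms(2) by (intro kl_ge) auto
  finally have "d\<^sup>2 / (2 * (p + d)) \<le> kl t u" .
  moreover have "c / n < d\<^sup>2 / (2 * (p + d))"
    using c n0 by (simp add: field_simps)
  ultimately have "ereal (c / n) < Kplus t u"
    using u0 u t assms(2) by (simp add: Kplus_eq)
  then show ?thesis
    unfolding ereal_less_BJ_plus_iff[OF assms(1)] t_def u_def using kn(1) by blast
qed

text \<open>The excess \<open>2 * d\<close> is spent in two halves: one absorbs the lower deviation
  of the count, the other remains as the surplus that makes the statistic large.\<close>

lemma BJ_plus_prob_ge:
  assumes "2 \<le> n" "0 < d" and p: "p = p_value \<tau>" and half: "p + d + 1 / n \<le> 1 / 2"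
    and M: "prob_space M" "sets M = sets borel"
    and \<pi>: "p + 2 * d \<le> measure M {\<tau><..}"
    and R: "R \<le> n * d\<^sup>2 / (p + 2 * d)" and c: "c < R / 2"
  shows "1 - exp (- R / 4) \<le> measure (PiM {1..n} (\<lambda>_. M)) {X \<in> space (PiM {1..n} (\<lambda>_. M)). ereal c < BJ_plus n X}"
proof -
  interpret M: prob_space M by fact
  interpret P: product_prob_space "\<lambda>_. M" "{1..n}" ..
  let ?P = "PiM {1..n} (\<lambda>_. M)"
  let ?N = "\<lambda>X. card {j\<in>{1..n}. X j \<in> {\<tau><..}}"
  let ?E = "{X \<in> space ?P. ereal c < BJ_plus n X}"
  have A: "{\<tau><..} \<in> sets M" by (simp add: M(2))
  have p0: "0 < p" using p_value_pos p by simp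
  define S where "S = {X \<in> space ?P. real (?N X) < n * (p + d)}"
  have S: "S \<in> sets ?P"
    unfolding S_def using measurable_card_PiM[OF finite_atLeastAtMost A] by measurable
  have E: "?E \<in> sets ?P"
    using measurable_BJ_plus[OF M(2), of n] by measurable
  have "R / 2 \<le> n * d\<^sup>2 / (p + 2 * d) / 2" by (intro divide_right_mono R) simp
  also have "\<dots> = n * d\<^sup>2 / (2 * (p + 2 * d))" by (simp only: divide_divide_eq_left mult.commute)
  also have "\<dots> \<le> n * d\<^sup>2 / (2 * (p + d))"
    using p0 assms(2) by (intro divide_left_mono mult_pos_pos) auto
  finally have c': "c < n * d\<^sup>2 / (2 * (p + d))" using c by linarith
  have "space ?P - S \<subseteq> ?E"
    unfolding S_def using BJ_plus_gt_of_count[OF assms(1,2) p half c'] by (auto simp: not_less)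
  then have "measure ?P (space ?P - S) \<le> measure ?P ?E"
    using E by (rule P.finite_measure_mono)
  then have "1 - measure ?P S \<le> measure ?P ?E"
    by (simp only: P.prob_compl[OF S])
  moreover have "measure ?P S \<le> exp (- R / 4)"
  proof -
    \<comment> \<open>The minimiser of the Chernoff exponent
      \<open>(p + 2 * d) * l^2 - d * l\<close>, with minimum
      \<open>- d^2 / (4 * (p + 2 * d))\<close>.\<close>
    define l where "l = d / (2 * (p + 2 * d))"
    have l0: "0 < l" using assms(2) p0 by (simp add: l_def)
    define y where "y = exp (- l)"
    have y: "0 < y" "y \<le> 1" using l0 by (auto simp: y_def)
    \<comment> \<open>Follows from \<open>exp l \<ge> 1 + l\<close> and
      \<open>(1 - l + l^2) * (1 + l) = 1 + l^3 \<ge> 1\<close>.\<close>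
    have y2: "y - 1 \<le> - l + l\<^sup>2"
    proof -
      have "y * (1 + l) \<le> y * exp l" using y by (intro mult_left_mono exp_ge_add_one_self) auto
      also have "\<dots> = 1" by (simp add: y_def exp_minus)
      also have "\<dots> \<le> (1 - l + l\<^sup>2) * (1 + l)" using l0 by (simp add: algebra_simps power2_eq_square)
      finally show ?thesis using l0 by simp
    qed
    let ?s = "real n * (p + d)"
    have "measure ?P S \<le> (1 + measure M {\<tau><..} * (y - 1)) ^ card {1..n} * y powr (- ?s)"
    proof (rule prob_card_le_chernoff[OF M(1) A y(1) _ S])
      fix X assume "X \<in> S"
      then have "real (?N X) \<le> ?s" by (simp add: S_def)
      then have "y powr ?s \<le> y powr (real (?N X))"
        using y by (intro powr_mono') auto
      then show "y powr ?s \<le> y ^ ?N X" using y by (simp add: powr_realpow)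
    qed simp
    also have "\<dots> \<le> exp ((p + 2 * d) * (- l + l\<^sup>2)) ^ n * exp (l * ?s)"
    proof -
      have "measure M {\<tau><..} * (y - 1) \<le> (p + 2 * d) * (y - 1)"
        using \<pi> y by (intro mult_right_mono_neg) auto
      also have "\<dots> \<le> (p + 2 * d) * (- l + l\<^sup>2)"
        using y2 p0 assms(2) by (intro mult_left_mono) auto
      finally have "1 + measure M {\<tau><..} * (y - 1) \<le> 1 + (p + 2 * d) * (- l + l\<^sup>2)" by simp
      also have "\<dots> \<le> exp ((p + 2 * d) * (- l + l\<^sup>2))" by (rule exp_ge_add_one_self)
      finally have le: "1 + measure M {\<tau><..} * (y - 1) \<le> exp ((p + 2 * d) * (- l + l\<^sup>2))" .
      have "measure M {\<tau><..} * (1 - y) \<le> 1 * 1"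
        using y by (intro mult_mono) auto
      then have nonneg: "0 \<le> 1 + measure M {\<tau><..} * (y - 1)" by (simp add: algebra_simps)
      have "y powr (- ?s) = exp (l * ?s)" by (simp add: y_def powr_def)
      then show ?thesis using power_mono[OF le nonneg, of n] by simp
    qed
    also have "\<dots> = exp (real n * ((p + 2 * d) * (- l + l\<^sup>2) + l * (p + d)))"
      by (simp add: exp_of_nat_mult[symmetric] exp_add[symmetric] algebra_simps)
    also have "(p + 2 * d) * (- l + l\<^sup>2) + l * (p + d) = - (d\<^sup>2 / (p + 2 * d)) / 4"
    proof -
      have "D * (d / (2 * D)) = d / 2" if "0 < D" for D :: real using that by simp
      from this[of "p + 2 * d"] have q: "(p + 2 * d) * l = d / 2" using p0 assms(2) by (simp add: l_def)
      have "(p + 2 * d) * (- l + l\<^sup>2) + l * (p + d) = l * ((p + 2 * d) * l - d)"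
        by (simp add: power2_eq_square algebra_simps)
      also have "\<dots> = - (d\<^sup>2 / (p + 2 * d)) / 4"
        unfolding q by (simp add: l_def power2_eq_square)
      finally show ?thesis .
    qed
    also have "exp (real n * (- (d\<^sup>2 / (p + 2 * d)) / 4)) \<le> exp (- R / 4)"
    proof -
      have "real n * (- (d\<^sup>2 / (p + 2 * d)) / 4) = - (real n * d\<^sup>2 / (p + 2 * d)) / 4"
        by (simp only: times_divide_eq_right mult_minus_right)
      moreover have "- Q / 4 \<le> - R / 4" if "R \<le> Q" for Q :: real using that by simp
      ultimately show ?thesis using R by (simp only: exp_le_cancel_iff)
    qed
    finally show ?thesis .
  qed
  ultimately show ?thesis by simp
qed

text \<open>The second part bounds the untruncated second moment; for \<open>r \<ge> 1/4\<close> the truncation is needed.\<close>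

lemma rho_star_lower:
  assumes "1/2 < \<beta>" "\<beta> < 1" "0 < r" "r < 1" "r < rho_star \<beta>"
  shows "1 - \<beta> < (1 - sqrt r)\<^sup>2" and "r < 1/4 \<Longrightarrow> 1 - 2 * \<beta> + 2 * r \<le> 0"
proof -
  have sq: "(sqrt r)\<^sup>2 = r" using assms by simp
  show "1 - \<beta> < (1 - sqrt r)\<^sup>2"
  proof (cases "\<beta> \<le> 3/4")
    case True
    \<comment> \<open>This square is the gap in \<open>\<beta>\<close> between the line
      \<open>\<beta> = r + 1/2\<close> and the curve \<open>\<beta> = 1 - (1 - sqrt r)^2\<close>,
      which touch at \<open>r = 1/4\<close>.\<close>
    have "0 \<le> 2 * (sqrt r - 1/2)\<^sup>2" by simp
    also have "\<dots> = (1 - sqrt r)\<^sup>2 + r - 1/2"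
      using sq by (simp add: power2_eq_square algebra_simps)
    finally show ?thesis using True assms by (simp add: rho_star_def)
  next
    case False
    have "(sqrt r)\<^sup>2 < (1 - sqrt (1 - \<beta>))\<^sup>2"
      using False assms sq by (simp add: rho_star_def)
    then have "sqrt r < 1 - sqrt (1 - \<beta>)"
      by (rule power2_less_imp_less) (use assms in auto)
    then have "(sqrt (1 - \<beta>))\<^sup>2 < (1 - sqrt r)\<^sup>2"
      using assms by (intro power_strict_mono) auto
    then show ?thesis using assms by simp
  qed
  show "1 - 2 * \<beta> + 2 * r \<le> 0" if "r < 1/4"
    using that assms by (auto simp: rho_star_def split: if_splits)
qed

text \<open>
  For the threshold \<open>w sqrt (2 log n)\<close> the last inequality says that the squared excess of the
  count, of order \<open>n powr (2 (1 - \<beta> - (w - sqrt r)\<^sup>2))\<close>, dominates its null variance, of order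
  \<open>n powr (1 - w\<^sup>2)\<close>.
\<close>

lemma rho_star_upper:
  assumes "1/2 < \<beta>" "\<beta> < 1" "0 < r" "r < 1" "rho_star \<beta> < r"
  shows "\<exists>w. sqrt r \<le> w \<and> w < 1 \<and> 2 * \<beta> + 2 * (w - sqrt r)\<^sup>2 < 1 + w\<^sup>2"
proof (cases "\<beta> \<le> 3/4 \<and> r < 1/4")
  case True
  have "(sqrt r)\<^sup>2 = r" using assms by simp
  moreover have "sqrt r < sqrt (1/4)" using True by (intro real_sqrt_less_mono) auto
  then have "2 * sqrt r < 1" by (simp add: real_sqrt_divide)
  \<comment> \<open>\<open>w = 2 * sqrt r\<close> maximises
    \<open>1 + w^2 - 2 * (w - sqrt r)^2\<close>; the maximum is \<open>1 + 2 * r\<close>.\<close>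
  ultimately show ?thesis
    using True assms by (intro exI[of _ "2 * sqrt r"]) (auto simp: rho_star_def power_mult_distrib)
next
  case False
  \<comment> \<open>Now \<open>r \<ge> 1/4\<close>, and the maximiser is no longer below 1. The
    condition is checked at the end point \<open>w = 1\<close>, and continuity moves it strictly
    inside.\<close>
  let ?h = "\<lambda>w. 1 + w\<^sup>2 - 2 * \<beta> - 2 * (w - sqrt r)\<^sup>2"
  have "(1 - sqrt r)\<^sup>2 < 1 - \<beta>"
  proof (cases "\<beta> \<le> 3/4")
    case True
    then have "1/4 \<le> r" using False by simp
    then have "sqrt (1/4) \<le> sqrt r" by (rule real_sqrt_le_mono)
    then have s: "1/2 \<le> sqrt r" by (simp add: real_sqrt_divide)
    show ?thesis
    \<comment> \<open>At the point of tangency strictness has to come from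
      \<open>\<beta> < 3/4\<close>; otherwise it comes from \<open>r > 1/4\<close>.\<close>
    proof (cases "r = 1/4")
      case True
      then have "sqrt r = sqrt ((1/2)\<^sup>2)" by (simp add: power2_eq_square)
      then have "sqrt r = 1/2" by simp
      moreover have "\<beta> < 3/4" using True assms \<open>\<beta> \<le> 3/4\<close> by (simp add: rho_star_def)
      ultimately show ?thesis by (simp only: power2_eq_square) simp
    next
      case False
      have "(sqrt r)\<^sup>2 = r" using assms by simp
      then have "sqrt r \<noteq> 1/2" using False power_one_over[of 2 2] by (intro notI) (simp only:, simp add: power2_eq_square)
      then have "(1 - sqrt r)\<^sup>2 < (1/2)\<^sup>2"
        using s assms by (intro power_strict_mono) auto
      then show ?thesis using True by (simp add: power2_eq_square)
    qed
  next
    case False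
    have "(1 - sqrt (1 - \<beta>))\<^sup>2 < (sqrt r)\<^sup>2"
      using False assms by (simp add: rho_star_def)
    then have "1 - sqrt (1 - \<beta>) < sqrt r"
      by (rule power2_less_imp_less) (use assms in auto)
    then have "(1 - sqrt r)\<^sup>2 < (sqrt (1 - \<beta>))\<^sup>2"
      using assms by (intro power_strict_mono) auto
    then show ?thesis using assms by simp
  qed
  then have "0 < ?h 1" by simp
  moreover have "(?h \<longlongrightarrow> ?h 1) (at_left 1)" by (intro tendsto_intros)
  ultimately have "\<forall>\<^sub>F w in at_left 1. 0 < ?h w"
    by (intro order_tendstoD(1))
  moreover have "\<forall>\<^sub>F w in at_left 1. w \<in> {sqrt r<..<1}"
    using assms by (intro eventually_at_leftI[of "sqrt r"]) auto
  ultimately have "\<forall>\<^sub>F w in at_left 1. 0 < ?h w \<and> w \<in> {sqrt r<..<1}"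
    by (rule eventually_conj)
  then obtain w where "0 < ?h w \<and> w \<in> {sqrt r<..<1}"
    using eventually_happens'[OF trivial_limit_at_left_real] by blast
  then show ?thesis by (intro exI[of _ w]) auto
qed

section \<open>Powerlessness below the boundary\<close>

lemma power_of_test_below_boundary:
  assumes \<beta>: "1/2 < \<beta>" "\<beta> < 1" and r: "0 < r" "r < 1" "r < rho_star \<beta>"
    and T: "\<And>n. T n \<in> borel_measurable (H0 n)"
    and \<alpha>: "vanishing_levels \<alpha>"
  shows "(\<lambda>n. power_of_test T \<beta> r n (\<alpha> n)) \<longlonglongrightarrow> 0"
proof -
  let ?\<delta> = "1 - \<beta> - (1 - sqrt r)\<^sup>2"
  let ?u = "\<lambda>n::nat. sqrt (\<alpha> n * exp 1) + real n powr ?\<delta>"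
  have neg: "?\<delta> < 0" using rho_star_lower(1)[OF \<beta> r] by simp
  have "\<alpha> \<longlonglongrightarrow> 0" using \<alpha> by (simp add: vanishing_levels_def)
  then have "(\<lambda>n. sqrt (\<alpha> n * exp 1)) \<longlonglongrightarrow> sqrt (0 * exp 1)"
    by (intro tendsto_intros)
  moreover have "(\<lambda>n::nat. real n powr ?\<delta>) \<longlonglongrightarrow> 0"
    using neg by (intro tendsto_neg_powr filterlim_real_sequentially)
  ultimately have lim: "?u \<longlonglongrightarrow> 0"
    using tendsto_add by fastforce
  have up: "\<forall>\<^sub>F n in sequentially. power_of_test T \<beta> r n (\<alpha> n) \<le> ?u n"
    using eventually_ge_at_top[of 2]
  proof eventually_elim
    case (elim n)
    define L where "L = ln (real n)"
    have L: "0 < L" using elim by (simp add: L_def)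
    have n_powr: "real n powr a = exp (a * L)" for a
      using elim by (simp add: powr_def L_def)
    define \<epsilon> where "\<epsilon> = real n powr (- \<beta>)"
    define \<mu> where "\<mu> = sqrt (2 * r * L)"
    define \<tau> where "\<tau> = sqrt (2 * L)"
    have \<mu>: "\<mu> = sqrt r * \<tau>" by (simp add: \<mu>_def \<tau>_def real_sqrt_mult)
    have \<tau>2: "\<tau>\<^sup>2 = 2 * L" using L by (simp add: \<tau>_def)
    have \<tau>0: "0 \<le> \<tau>" using L by (simp add: \<tau>_def)
    have \<mu>2: "\<mu>\<^sup>2 = 2 * r * L" using L r by (simp add: \<mu>_def)
    have \<mu>\<tau>: "\<mu> \<le> \<tau>" using r \<tau>0 by (simp add: \<mu> mult_left_le_one_le)
    have \<epsilon>: "0 \<le> \<epsilon>" "\<epsilon> \<le> 1" using L \<beta> unfolding \<epsilon>_def n_powr by auto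
    have \<epsilon>2: "real n * \<epsilon>\<^sup>2 = exp ((1 - 2 * \<beta>) * L)"
    proof -
      have "real n * \<epsilon>\<^sup>2 = real n powr 1 * (\<epsilon> * \<epsilon>)" using elim by (simp add: power2_eq_square)
      then show ?thesis
        unfolding \<epsilon>_def n_powr by (simp add: exp_add[symmetric] algebra_simps)
    qed
    let ?J = "\<integral>\<^sup>+x. ennreal (normal_density (2 * \<mu>) 1 x) * indicator {..\<tau>} x \<partial>lborel"
    \<comment> \<open>\<open>r < 1/4\<close> means \<open>2 * \<mu> < \<tau>\<close>: the normal law
      with mean \<open>2 * \<mu>\<close> then lies mostly below \<open>\<tau>\<close>, and its full
      mass is a good enough bound. Otherwise \<open>{..\<tau>}\<close> is a lower tail of that law
      and its small probability is used.\<close>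
    have "\<exists>V\<ge>0. ennreal (exp (\<mu>\<^sup>2)) * ?J \<le> ennreal V \<and> real n * \<epsilon>\<^sup>2 * V \<le> 1"
    proof (cases "r < 1/4")
      case True
      have "?J \<le> (\<integral>\<^sup>+x. ennreal (normal_density (2 * \<mu>) 1 x) \<partial>lborel)"
        by (intro nn_integral_mono) (auto simp: indicator_def)
      then have "ennreal (exp (\<mu>\<^sup>2)) * ?J \<le> ennreal (exp (\<mu>\<^sup>2)) * 1"
        by (intro mult_left_mono) auto
      moreover have "real n * \<epsilon>\<^sup>2 * exp (\<mu>\<^sup>2) \<le> 1"
      proof -
        have "real n * \<epsilon>\<^sup>2 * exp (\<mu>\<^sup>2) = exp ((1 - 2 * \<beta> + 2 * r) * L)"
          unfolding \<epsilon>2 \<mu>2 by (simp add: exp_add[symmetric] algebra_simps)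
        then show ?thesis using rho_star_lower(2)[OF \<beta> r True] L by (simp add: mult_nonpos_nonneg)
      qed
      ultimately show ?thesis by (intro exI[of _ "exp (\<mu>\<^sup>2)"]) auto
    next
      case False
      then have "sqrt (1/4) \<le> sqrt r" by (intro real_sqrt_le_mono) simp
      then have s: "1/2 \<le> sqrt r" by (simp add: real_sqrt_divide)
      have "\<tau> \<le> 2 * \<mu>" using mult_right_mono[OF s \<tau>0] by (simp add: \<mu>)
      then have "?J \<le> ennreal (exp (- (\<tau> - 2 * \<mu>)\<^sup>2 / 2))"
        by (intro normal_set_nn_integral_le) (auto intro: mult_nonpos_nonpos)
      then have "ennreal (exp (\<mu>\<^sup>2)) * ?J \<le> ennreal (exp (\<mu>\<^sup>2)) * ennreal (exp (- (\<tau> - 2 * \<mu>)\<^sup>2 / 2))"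
        by (intro mult_left_mono) auto
      also have "\<dots> = ennreal (exp (\<mu>\<^sup>2 - (\<tau> - 2 * \<mu>)\<^sup>2 / 2))"
        by (simp add: exp_add[symmetric] flip: ennreal_mult)
      finally have J: "ennreal (exp (\<mu>\<^sup>2)) * ?J \<le> ennreal (exp (\<mu>\<^sup>2 - (\<tau> - 2 * \<mu>)\<^sup>2 / 2))" .
      have "(\<tau> - 2 * \<mu>)\<^sup>2 = (1 - 2 * sqrt r)\<^sup>2 * \<tau>\<^sup>2"
        unfolding \<mu> by (simp add: power2_eq_square algebra_simps)
      then have "\<mu>\<^sup>2 - (\<tau> - 2 * \<mu>)\<^sup>2 / 2 = (2 * r - (1 - 2 * sqrt r)\<^sup>2) * L"
        unfolding \<tau>2 \<mu>2 by (simp add: algebra_simps)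
      then have "real n * \<epsilon>\<^sup>2 * exp (\<mu>\<^sup>2 - (\<tau> - 2 * \<mu>)\<^sup>2 / 2) = exp ((1 - 2 * \<beta> + 2 * r - (1 - 2 * sqrt r)\<^sup>2) * L)"
        unfolding \<epsilon>2 by (simp add: exp_add[symmetric] algebra_simps)
      \<comment> \<open>The truncated second moment has exactly twice the exponent of the removed
        mass, so one inequality controls both.\<close>
      also have "1 - 2 * \<beta> + 2 * r - (1 - 2 * sqrt r)\<^sup>2 = 2 * ?\<delta>"
        using r by (simp add: power2_diff power_mult_distrib)
      also have "exp (2 * ?\<delta> * L) \<le> 1"
        using neg L by (simp add: mult_nonpos_nonneg)
      finally have "real n * \<epsilon>\<^sup>2 * exp (\<mu>\<^sup>2 - (\<tau> - 2 * \<mu>)\<^sup>2 / 2) \<le> 1" .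
      then show ?thesis using J by (intro exI[of _ "exp (\<mu>\<^sup>2 - (\<tau> - 2 * \<mu>)\<^sup>2 / 2)"]) auto
    qed
    then obtain V where V: "0 \<le> V" "ennreal (exp (\<mu>\<^sup>2)) * ?J \<le> ennreal V" "real n * \<epsilon>\<^sup>2 * V \<le> 1"
      by auto
    let ?c = "critical_value T n (\<alpha> n)"
    have sp: "space (H1 \<beta> r n) = space (H0 n)"
      by (simp add: H1_def H0_def space_PiM)
    let ?A = "{X \<in> space (H0 n). ?c < T n X}"
    have A: "?A \<in> sets (H0 n)" using T[of n] by measurable
    have "power_of_test T \<beta> r n (\<alpha> n) = measure (H1 \<beta> r n) ?A"
      by (simp add: power_of_test_def sp)
    also have "\<dots> \<le> sqrt (measure (H0 n) ?A * exp (real n * \<epsilon>\<^sup>2 * V)) + real n * (\<epsilon> * exp (- (\<tau> - \<mu>)\<^sup>2 / 2))"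
      using normal_mixture_prob_le[OF \<epsilon> \<mu>\<tau> V(1,2) A[unfolded H0_def]]
      by (simp add: H0_def H1_def \<epsilon>_def \<mu>_def L_def)
    also have "sqrt (measure (H0 n) ?A * exp (real n * \<epsilon>\<^sup>2 * V)) \<le> sqrt (\<alpha> n * exp 1)"
    proof -
      have "0 \<le> \<alpha> n" using \<alpha> by (simp add: vanishing_levels_def less_imp_le)
      then show ?thesis
        using critical_value_attained[of T n "\<alpha> n"] T V(3)
        by (intro real_sqrt_le_mono mult_mono) auto
    qed
    also have "real n * (\<epsilon> * exp (- (\<tau> - \<mu>)\<^sup>2 / 2)) = real n powr ?\<delta>"
    proof -
      have "(\<tau> - \<mu>)\<^sup>2 = (1 - sqrt r)\<^sup>2 * \<tau>\<^sup>2"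
        unfolding \<mu> by (simp add: power2_eq_square algebra_simps)
      then have "- (\<tau> - \<mu>)\<^sup>2 / 2 = - (1 - sqrt r)\<^sup>2 * L" by (simp add: \<tau>2)
      moreover have "real n = exp (1 * L)" using elim by (simp add: L_def)
      ultimately show ?thesis
        unfolding \<epsilon>_def n_powr by (simp add: exp_add[symmetric] algebra_simps)
    qed
    finally show ?case by simp
  qed
  have "\<forall>\<^sub>F n in sequentially. 0 \<le> power_of_test T \<beta> r n (\<alpha> n)"
    by (simp add: power_of_test_def)
  from tendsto_sandwich[OF this up tendsto_const lim] show ?thesis .
qed

section \<open>Full power above the boundary\<close>

text \<open>The exponent is \<open>s^2 * ln n\<close> up to \<open>O(sqrt (ln n))\<close>, and
  \<open>\<eta> * ln n\<close> absorbs this remainder and all constants. The factor 3 is what the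
  excess over the null tail will consume.\<close>

lemma std_normal_tail_lower_asymp:
  assumes "0 \<le> s" "s \<le> 1" "0 < \<eta>"
  shows "\<forall>\<^sub>F n::nat in sequentially.
    3 * real n powr (- (s\<^sup>2 + \<eta>)) \<le> normal_density 0 1 (s * sqrt (2 * ln (real n)) + 1)"
proof -
  have "\<forall>\<^sub>F n::nat in sequentially. sqrt (2 * ln (real n)) + 1/2 + ln (3 * sqrt (2 * pi)) \<le> \<eta> * ln (real n)"
    using assms(3) by real_asymp
  then show ?thesis
    using eventually_ge_at_top[of 2]
  proof eventually_elim
    case (elim n)
    define L where "L = ln (real n)"
    have L: "0 < L" using elim by (simp add: L_def)
    have "(s * sqrt (2 * L) + 1)\<^sup>2 / 2 = s\<^sup>2 * L + s * sqrt (2 * L) + 1/2"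
      using L by (simp add: power2_sum power_mult_distrib algebra_simps)
    also have "s * sqrt (2 * L) \<le> sqrt (2 * L)"
      using assms L by (simp add: mult_left_le_one_le)
    finally have "ln (3 * sqrt (2 * pi)) + - ((s\<^sup>2 + \<eta>) * L) \<le> - (s * sqrt (2 * L) + 1)\<^sup>2 / 2"
      using elim(1) by (simp add: L_def[symmetric] algebra_simps)
    then have "exp (ln (3 * sqrt (2 * pi)) + - ((s\<^sup>2 + \<eta>) * L)) \<le> exp (- (s * sqrt (2 * L) + 1)\<^sup>2 / 2)"
      by (simp only: exp_le_cancel_iff)
    then have "3 * sqrt (2 * pi) * exp (- ((s\<^sup>2 + \<eta>) * L)) \<le> exp (- (s * sqrt (2 * L) + 1)\<^sup>2 / 2)"
      by (simp only: exp_add) simp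
    then have "3 * exp (- ((s\<^sup>2 + \<eta>) * L)) \<le> exp (- (s * sqrt (2 * L) + 1)\<^sup>2 / 2) / sqrt (2 * pi)"
      by (simp add: field_simps)
    then show ?case
      using elim(2) unfolding std_normal_density_def powr_def by (simp add: L_def del: minus_add_distrib)
  qed
qed

lemma power_of_test_above_boundary:
  assumes \<beta>: "1/2 < \<beta>" "\<beta> < 1" and r: "0 < r" "r < 1" "rho_star \<beta> < r"
    and \<alpha>: "vanishing_levels \<alpha>" "\<forall>\<^sub>F n in sequentially. 1 / (real n + 2) \<le> \<alpha> n"
  shows "(\<lambda>n. power_of_test BJ_plus \<beta> r n (\<alpha> n)) \<longlonglongrightarrow> 1"
proof -
  obtain w where w: "sqrt r \<le> w" "w < 1" "2 * \<beta> + 2 * (w - sqrt r)\<^sup>2 < 1 + w\<^sup>2"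
    using rho_star_upper[OF \<beta> r] by auto
  \<comment> \<open>All are exponents of \<open>n\<close>, or distances in units of
    \<open>sqrt (2 * ln n)\<close>: \<open>s\<close> from signal mean to threshold,
    \<open>\<gamma>\<close> for the excess \<open>d\<close> (signal tail with slack
    \<open>\<eta>\<close>), \<open>\<kappa>\<close> for \<open>p + 2 * d\<close>,
    \<open>\<delta>\<close> for \<open>n * d^2 / (p + 2 * d)\<close>. The first entry of the minimum
    keeps \<open>2 * \<gamma> < 1 + w^2\<close>; the second makes the null tail no larger than the
    bound for the signal tail.\<close>
  define s where "s = w - sqrt r"
  define \<eta> where "\<eta> = min ((1 + w\<^sup>2 - 2 * \<beta> - 2 * s\<^sup>2) / 4) (w\<^sup>2 - s\<^sup>2)"
  define \<gamma> where "\<gamma> = \<beta> + s\<^sup>2 + \<eta>"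
  define \<kappa> where "\<kappa> = min (w\<^sup>2) \<gamma>"
  define \<delta> where "\<delta> = 1 - 2 * \<gamma> + \<kappa>"
  have w0: "0 < w" using w r by (meson less_le_trans real_sqrt_gt_zero)
  have s: "0 \<le> s" "s \<le> 1" "s < w" using w r real_sqrt_gt_zero[OF r(1)] unfolding s_def by linarith+
  then have "s\<^sup>2 < w\<^sup>2" by (intro power_strict_mono) auto
  moreover have "\<eta> \<le> (1 + w\<^sup>2 - 2 * \<beta> - 2 * s\<^sup>2) / 4" "\<eta> \<le> w\<^sup>2 - s\<^sup>2"
    unfolding \<eta>_def by (rule min.cobounded1, rule min.cobounded2)
  ultimately have \<eta>: "0 < \<eta>" "4 * \<eta> \<le> 1 + w\<^sup>2 - 2 * \<beta> - 2 * s\<^sup>2" "s\<^sup>2 + \<eta> \<le> w\<^sup>2"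
    using w(3) by (simp_all add: \<eta>_def s_def[symmetric])
  have w2: "w\<^sup>2 < 1" "0 < w\<^sup>2" using w w0 by (auto simp: power_less_one_iff abs_square_less_1)
  have \<gamma>: "2 * \<gamma> < 1 + w\<^sup>2" using \<eta> by (simp add: \<gamma>_def)
  have \<gamma>01: "0 < \<gamma>" "\<gamma> < 1" using \<gamma> w2 \<beta> \<eta> by (auto simp: \<gamma>_def add_pos_nonneg)
  have \<delta>0: "0 < \<delta>" using \<gamma> \<gamma>01 by (auto simp: \<delta>_def \<kappa>_def min_def)
  let ?R = "\<lambda>n::nat. real n powr \<delta> / 3"
  have ev1: "\<forall>\<^sub>F n::nat in sequentially. real n powr (- w\<^sup>2) + real n powr (- \<gamma>) + 1 / real n \<le> 1 / 2"
  proof -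
    have "(\<lambda>n::nat. real n powr (- w\<^sup>2) + real n powr (- \<gamma>) + 1 / real n) \<longlonglongrightarrow> 0 + 0 + 0"
      using w2 \<gamma>01 by (intro tendsto_add tendsto_neg_powr filterlim_real_sequentially lim_1_over_n) auto
    then have "\<forall>\<^sub>F n::nat in sequentially. real n powr (- w\<^sup>2) + real n powr (- \<gamma>) + 1 / real n < 1 / 2"
      by (rule order_tendstoD) simp
    then show ?thesis by eventually_elim simp
  qed
  have ev2: "\<forall>\<^sub>F n::nat in sequentially. 3 * ln (real n) < real n powr \<delta> / 3 / 2"
    using \<delta>0 by real_asymp
  have lim: "(\<lambda>n::nat. 1 - exp (- (real n powr \<delta> / 3) / 4)) \<longlonglongrightarrow> 1"
    using \<delta>0 by real_asymp
  have ev: "\<forall>\<^sub>F n in sequentially. 1 - exp (- ?R n / 4) \<le> power_of_test BJ_plus \<beta> r n (\<alpha> n)"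
    using ev1 ev2 \<alpha>(2) std_normal_tail_lower_asymp[OF s(1,2) \<eta>(1)] eventually_ge_at_top[of 2]
  proof eventually_elim
    case (elim n)
    define L where "L = ln (real n)"
    have L: "0 < L" using elim by (simp add: L_def)
    have n_powr: "real n powr a = exp (a * L)" for a
      using elim by (simp add: powr_def L_def)
    define \<epsilon> where "\<epsilon> = real n powr (- \<beta>)"
    define \<mu> where "\<mu> = sqrt (2 * r * L)"
    define \<tau> where "\<tau> = w * sqrt (2 * L)"
    define d where "d = real n powr (- \<gamma>)"
    define M where "M = normal_mixture \<epsilon> \<mu>"
    let ?p = "p_value \<tau>"
    have \<mu>: "\<tau> - \<mu> = s * sqrt (2 * L)" by (simp add: \<mu>_def \<tau>_def s_def real_sqrt_mult algebra_simps)
    have \<tau>0: "0 \<le> \<tau>" using L w0 by (simp add: \<tau>_def)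
    have \<mu>\<tau>: "\<mu> \<le> \<tau>" using \<mu> mult_nonneg_nonneg[OF s(1), of "sqrt (2 * L)"] L by simp
    have \<epsilon>: "0 \<le> \<epsilon>" "\<epsilon> \<le> 1" using L \<beta> unfolding \<epsilon>_def n_powr by auto
    have d0: "0 < d" using elim by (simp add: d_def)
    have p0: "0 < ?p" by (rule p_value_pos)
    have p: "?p \<le> real n powr (- w\<^sup>2)"
      using p_value_le_exp[OF \<tau>0] L by (simp add: \<tau>_def n_powr power_mult_distrib)
    have d: "d = \<epsilon> * real n powr (- (s\<^sup>2 + \<eta>))"
      unfolding d_def \<epsilon>_def n_powr by (simp add: exp_add[symmetric] \<gamma>_def algebra_simps)
    interpret M: prob_space M unfolding M_def using \<epsilon> by (rule prob_space_normal_mixture)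
    interpret N: prob_space std_normal by (rule prob_space_std_normal)
    have M': "sets M = sets borel" by (simp add: M_def)
    have "ennreal ((1 - \<epsilon>) * ?p + \<epsilon> * normal_density 0 1 (\<tau> + 1 - \<mu>)) =
       ennreal (1 - \<epsilon>) * ennreal ?p + ennreal \<epsilon> * ennreal (normal_density 0 1 (\<tau> + 1 - \<mu>))"
      using \<epsilon> p0 by (simp add: ennreal_mult)
    also have "\<dots> \<le> ennreal (1 - \<epsilon>) * emeasure std_normal {\<tau><..} +
       ennreal \<epsilon> * (\<integral>\<^sup>+x. ennreal (normal_density \<mu> 1 x) * indicator {\<tau><..} x \<partial>lborel)"
      by (intro add_mono mult_left_mono normal_tail_ge \<mu>\<tau>) (simp_all add: p_value_def N.emeasure_eq_measure)
    also have "\<dots> = ennreal (measure M {\<tau><..})"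
      unfolding M.emeasure_eq_measure[symmetric] unfolding M_def using \<epsilon> by (simp add: emeasure_normal_mixture)
    finally have low: "(1 - \<epsilon>) * ?p + \<epsilon> * normal_density 0 1 (\<tau> + 1 - \<mu>) \<le> measure M {\<tau><..}"
      by simp
    have "?p \<le> real n powr (- (s\<^sup>2 + \<eta>))"
    proof -
      have "real n powr (- w\<^sup>2) \<le> real n powr (- (s\<^sup>2 + \<eta>))"
        using \<eta>(3) elim(5) by (intro powr_mono) auto
      then show ?thesis using p by linarith
    qed
    \<comment> \<open>The signal tail must supply \<open>2 * d\<close> and also repay the
      \<open>\<epsilon> * ?p\<close> of null mass that mixing removes.\<close>
    then have "?p + 2 * real n powr (- (s\<^sup>2 + \<eta>)) \<le> 3 * real n powr (- (s\<^sup>2 + \<eta>))" by simp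
    also have "\<dots> \<le> normal_density 0 1 (\<tau> - \<mu> + 1)"
      using elim(4) unfolding \<mu> L_def .
    finally have "\<epsilon> * (?p + 2 * real n powr (- (s\<^sup>2 + \<eta>))) \<le> \<epsilon> * normal_density 0 1 (\<tau> + 1 - \<mu>)"
      using \<epsilon> by (intro mult_left_mono) (simp_all add: algebra_simps)
    then have \<pi>: "?p + 2 * d \<le> measure M {\<tau><..}"
      using low by (simp add: d algebra_simps)
    have half: "?p + d + 1 / real n \<le> 1 / 2"
      using elim(1) p by (simp add: d_def)
    have R: "?R n \<le> real n * d\<^sup>2 / (?p + 2 * d)"
    proof -
      have "real n powr (- w\<^sup>2) \<le> real n powr (- \<kappa>)" "real n powr (- \<gamma>) \<le> real n powr (- \<kappa>)"
        using L unfolding n_powr by (auto simp: \<kappa>_def)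
      then have le: "?p + 2 * d \<le> 3 * real n powr (- \<kappa>)"
        using p by (simp add: d_def)
      have nd: "real n * d\<^sup>2 = real n powr (1 - 2 * \<gamma>)"
      proof -
        have "real n * d\<^sup>2 = real n powr 1 * (d * d)" using elim by (simp add: power2_eq_square)
        then show ?thesis unfolding d_def n_powr by (simp add: exp_add[symmetric] algebra_simps)
      qed
      have "?R n = real n powr (1 - 2 * \<gamma>) / (3 * real n powr (- \<kappa>))"
        unfolding \<delta>_def n_powr by (simp add: exp_minus exp_add[symmetric] field_simps)
      also have "\<dots> \<le> real n powr (1 - 2 * \<gamma>) / (?p + 2 * d)"
        using le p0 d0 elim by (intro divide_left_mono) auto
      finally show ?thesis by (simp add: nd)
    qed
    have "1 - exp (- ?R n / 4) \<le> measure (PiM {1..n} (\<lambda>_. M))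
        {X \<in> space (PiM {1..n} (\<lambda>_. M)). ereal (3 * L) < BJ_plus n X}"
      using elim(2) by (intro BJ_plus_prob_ge[OF elim(5) d0 refl half M.prob_space_axioms M' \<pi> R]) (simp add: L_def)
    also have "\<dots> \<le> measure (PiM {1..n} (\<lambda>_. M))
        {X \<in> space (PiM {1..n} (\<lambda>_. M)). critical_value BJ_plus n (\<alpha> n) < BJ_plus n X}"
    proof -
      interpret P: product_prob_space "\<lambda>_. M" "{1..n}" ..
      \<comment> \<open>The 3 in \<open>3 * L\<close> leaves \<open>n * n^(-3) = n^(-2)\<close>
        after the union bound, which is below \<open>1 / (n + 2)\<close> from \<open>n = 2\<close>
        on.\<close>
      have "measure (H0 n) {X \<in> space (H0 n). ereal (3 * L) < BJ_plus n X} \<le> real n * exp (- (3 * L))"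
        using L by (intro H0_BJ_plus_bound elim(5)) simp
      also have "\<dots> = 1 / (real n)\<^sup>2"
      proof -
        have n0: "0 < real n" using elim(5) by simp
        have "exp (- (3 * L)) = inverse (exp L ^ 3)"
          using exp_of_nat_mult[of 3 L] by (simp add: exp_minus)
        also have "exp L = real n" using n0 by (simp add: L_def)
        finally have "real n * exp (- (3 * L)) = real n * inverse (real n ^ 3)" by (rule arg_cong)
        then show ?thesis using n0 by (simp add: power2_eq_square power3_eq_cube divide_simps)
      qed
      also have "\<dots> \<le> 1 / (real n + 2)"
      proof -
        have n2: "2 \<le> real n" using elim(5) by simp
        then have "2 * real n \<le> real n * real n" by (intro mult_right_mono) auto
        then have "real n + 2 \<le> (real n)\<^sup>2" unfolding power2_eq_square using n2 by linarith
        then show ?thesis using n2 by (intro divide_left_mono mult_pos_pos) auto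
      qed
      also have "\<dots> \<le> \<alpha> n" by (rule elim(3))
      finally have cv: "critical_value BJ_plus n (\<alpha> n) \<le> ereal (3 * L)"
        by (rule critical_value_le)
      have "{X \<in> space (PiM {1..n} (\<lambda>_. M)). critical_value BJ_plus n (\<alpha> n) < BJ_plus n X}
          \<in> sets (PiM {1..n} (\<lambda>_. M))"
        using measurable_BJ_plus[OF M', of n] by measurable
      moreover have "{X \<in> space (PiM {1..n} (\<lambda>_. M)). ereal (3 * L) < BJ_plus n X} \<subseteq>
          {X \<in> space (PiM {1..n} (\<lambda>_. M)). critical_value BJ_plus n (\<alpha> n) < BJ_plus n X}"
        using le_less_trans[OF cv] by blast
      ultimately show ?thesis
        by (rule P.finite_measure_mono[rotated])
    qed
    also have "\<dots> = power_of_test BJ_plus \<beta> r n (\<alpha> n)"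
      by (simp add: power_of_test_def H1_def M_def \<epsilon>_def \<mu>_def L_def)
    finally show ?case by simp
  qed
  have up: "\<forall>\<^sub>F n in sequentially. power_of_test BJ_plus \<beta> r n (\<alpha> n) \<le> 1"
    using eventually_ge_at_top[of 1]
  proof eventually_elim
    case (elim n)
    have "real n powr (- \<beta>) \<le> 1" using elim \<beta> by (simp add: powr_minus ge_one_powr_ge_zero field_simps)
    then interpret P: product_prob_space "\<lambda>_. normal_mixture (real n powr (- \<beta>)) (sqrt (2 * r * ln (real n)))" "{1..n}"
      by (intro product_prob_spaceI prob_space_normal_mixture) auto
    show ?case unfolding power_of_test_def H1_def by (rule P.prob_le_1)
  qed
  show ?thesis
    by (rule tendsto_sandwich[OF ev up lim tendsto_const])
qed

lemma is_detection_boundary_BJ_plus: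
  assumes "\<And>\<beta>. 1/2 < \<beta> \<Longrightarrow> \<beta> < 1 \<Longrightarrow> \<rho> \<beta> = rho_star \<beta>"
  shows "is_detection_boundary BJ_plus \<rho>"
  unfolding is_detection_boundary_def
\<comment> \<open>The shift by 2 keeps the level strictly between 0 and 1 even at
  \<open>n = 0\<close>.\<close>
proof (intro exI[of _ "\<lambda>n. 1 / (real n + 2)"] conjI allI impI)
  have "(\<lambda>n. 1 / (real n + 2)) \<longlonglongrightarrow> 0" by real_asymp
  then show "vanishing_levels (\<lambda>n. 1 / (real n + 2))"
    by (simp add: vanishing_levels_def)
next
  fix \<alpha> :: "nat \<Rightarrow> real" and \<beta> r :: real
  assume *: "vanishing_levels \<alpha> \<and> (\<forall>\<^sub>F n in sequentially. 1 / (real n + 2) \<le> \<alpha> n)"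
    "1 / 2 < \<beta> \<and> \<beta> < 1 \<and> 0 < r \<and> r < 1"
  show "(\<lambda>n. power_of_test BJ_plus \<beta> r n (\<alpha> n)) \<longlonglongrightarrow> 1" if "\<rho> \<beta> < r"
    using that * assms by (intro power_of_test_above_boundary) auto
  show "(\<lambda>n. power_of_test BJ_plus \<beta> r n (\<alpha> n)) \<longlonglongrightarrow> 0" if "r < \<rho> \<beta>"
  proof (rule power_of_test_below_boundary)
    show "BJ_plus n \<in> borel_measurable (H0 n)" for n
      unfolding H0_def by (rule measurable_BJ_plus) simp
  qed (use that * assms in auto)
qed

section \<open>Uniqueness of the boundary\<close>

lemma rho_star_bounds:
  assumes "1/2 < \<beta>" "\<beta> < 1"
  shows "0 < rho_star \<beta>" "rho_star \<beta> < 1"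
proof -
  have "0 < sqrt (1 - \<beta>)" "sqrt (1 - \<beta>) < 1" using assms by auto
  then have "0 < (1 - sqrt (1 - \<beta>))\<^sup>2" "(1 - sqrt (1 - \<beta>))\<^sup>2 < 1"
    by (auto simp: abs_square_less_1)
  then show "0 < rho_star \<beta>" "rho_star \<beta> < 1"
    using assms by (auto simp: rho_star_def)
qed

text \<open>At an \<open>r\<close> strictly between two boundaries the power would tend both to 0
  and to 1. The pointwise maximum of the two rates still vanishes and is slow enough for
  both.\<close>

lemma detection_boundary_unique:
  assumes \<rho>: "is_detection_boundary T \<rho>" and \<rho>': "is_detection_boundary T \<rho>'"
    and \<beta>: "1/2 < \<beta>" "\<beta> < 1" and bounds: "0 < \<rho>' \<beta>" "\<rho>' \<beta> < 1"
  shows "\<rho> \<beta> = \<rho>' \<beta>"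
proof (rule ccontr)
  assume ne: "\<rho> \<beta> \<noteq> \<rho>' \<beta>"
  obtain \<alpha>\<^sub>1 where \<alpha>\<^sub>1: "vanishing_levels \<alpha>\<^sub>1" and 1: "\<And>\<alpha> r. vanishing_levels \<alpha> \<Longrightarrow>
      \<forall>\<^sub>F n in sequentially. \<alpha>\<^sub>1 n \<le> \<alpha> n \<Longrightarrow> 0 < r \<Longrightarrow> r < 1 \<Longrightarrow>
      (\<rho> \<beta> < r \<longrightarrow> (\<lambda>n. power_of_test T \<beta> r n (\<alpha> n)) \<longlonglongrightarrow> 1) \<and>
      (r < \<rho> \<beta> \<longrightarrow> (\<lambda>n. power_of_test T \<beta> r n (\<alpha> n)) \<longlonglongrightarrow> 0)"
    using \<rho> \<beta> unfolding is_detection_boundary_def by blast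
  obtain \<alpha>\<^sub>2 where \<alpha>\<^sub>2: "vanishing_levels \<alpha>\<^sub>2" and 2: "\<And>\<alpha> r. vanishing_levels \<alpha> \<Longrightarrow>
      \<forall>\<^sub>F n in sequentially. \<alpha>\<^sub>2 n \<le> \<alpha> n \<Longrightarrow> 0 < r \<Longrightarrow> r < 1 \<Longrightarrow>
      (\<rho>' \<beta> < r \<longrightarrow> (\<lambda>n. power_of_test T \<beta> r n (\<alpha> n)) \<longlonglongrightarrow> 1) \<and>
      (r < \<rho>' \<beta> \<longrightarrow> (\<lambda>n. power_of_test T \<beta> r n (\<alpha> n)) \<longlonglongrightarrow> 0)"
    using \<rho>' \<beta> unfolding is_detection_boundary_def by blast
  define \<alpha> where "\<alpha> n = max (\<alpha>\<^sub>1 n) (\<alpha>\<^sub>2 n)" for n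
  have "\<alpha> \<longlonglongrightarrow> max 0 0"
    using \<alpha>\<^sub>1 \<alpha>\<^sub>2 unfolding \<alpha>_def[abs_def] vanishing_levels_def by (intro tendsto_max) auto
  then have \<alpha>: "vanishing_levels \<alpha>"
    using \<alpha>\<^sub>1 \<alpha>\<^sub>2 by (auto simp: vanishing_levels_def \<alpha>_def less_max_iff_disj)
  have "\<forall>\<^sub>F n in sequentially. \<alpha>\<^sub>1 n \<le> \<alpha> n" "\<forall>\<^sub>F n in sequentially. \<alpha>\<^sub>2 n \<le> \<alpha> n"
    by (simp_all add: \<alpha>_def)
  note lim = 1[OF \<alpha> this(1)] 2[OF \<alpha> this(2)]
  \<comment> \<open>\<open>\<rho> \<beta>\<close> may be any real number, whereas the power
    statements concern \<open>0 < r < 1\<close>. Since \<open>\<rho>' \<beta>\<close> lies inside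
    this interval, clipping \<open>\<rho> \<beta>\<close> to it still leaves a gap.\<close>
  obtain r where r: "0 < r" "r < 1" and "\<rho> \<beta> < r \<and> r < \<rho>' \<beta> \<or> \<rho>' \<beta> < r \<and> r < \<rho> \<beta>"
  proof (cases "\<rho> \<beta> < \<rho>' \<beta>")
    case True
    then obtain r where "max 0 (\<rho> \<beta>) < r" "r < \<rho>' \<beta>"
      using dense[of "max 0 (\<rho> \<beta>)" "\<rho>' \<beta>"] bounds by auto
    then show ?thesis using that[of r] bounds by auto
  next
    case False
    then obtain r where "\<rho>' \<beta> < r" "r < min 1 (\<rho> \<beta>)"
      using dense[of "\<rho>' \<beta>" "min 1 (\<rho> \<beta>)"] bounds ne by auto
    then show ?thesis using that[of r] bounds by auto
  qed
  then have "(\<lambda>n. power_of_test T \<beta> r n (\<alpha> n)) \<longlonglongrightarrow> 0" "(\<lambda>n. power_of_test T \<beta> r n (\<alpha> n)) \<longlonglongrightarrow> 1"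
    using lim[of r] by auto
  then show False using LIMSEQ_unique by fastforce
qed

theorem theorem1p6:
  fixes \<rho>_BJ :: "real \<Rightarrow> real"
  shows "is_detection_boundary BJ_plus \<rho>_BJ \<longleftrightarrow>
    (\<forall>\<beta>. 1/2 < \<beta> \<and> \<beta> < 1 \<longrightarrow> \<rho>_BJ \<beta> = rho_star \<beta>)"
proof
  assume "is_detection_boundary BJ_plus \<rho>_BJ"
  then show "\<forall>\<beta>. 1/2 < \<beta> \<and> \<beta> < 1 \<longrightarrow> \<rho>_BJ \<beta> = rho_star \<beta>"
    using detection_boundary_unique is_detection_boundary_BJ_plus rho_star_bounds by blast
next
  assume "\<forall>\<beta>. 1/2 < \<beta> \<and> \<beta> < 1 \<longrightarrow> \<rho>_BJ \<beta> = rho_star \<beta>"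
  then show "is_detection_boundary BJ_plus \<rho>_BJ"
    by (intro is_detection_boundary_BJ_plus) auto
qed

end
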